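(* Let $n$ be a positive integer, let $X_1$ be a Banach space with cotype $2$, and let $1\le p\le s\le 2$. Then $$\Pi_{(s;s,t,\dots,t)}^{n}(X_{1},\dots,X_{n};Z)\subset\Pi_{(p;p,t,\dots,t)}^{n}(X_{1},\dots,X_{n};Z)$$ for all Banach spaces $X_2,\dots,X_n,Z$ and all real $t\ge 1$. In particular, $$\Pi_{(s;s,\dots,s)}^{n}(X_{1},\dots,X_{n};Z)\subset\Pi_{(p;p,s,\dots,s)}^{n}(X_{1},\dots,X_{n};Z)\subset\Pi_{(p;p,p,\dots,p)}^{n}(X_{1},\dots,X_{n};Z)$$ for all Banach spaces $X_2,\dots,X_n,Z$.
   Context: All Banach spaces are over $\mathbb{K}=\mathbb{R}$ or $\mathbb{C}$. For a Banach space $X$ with dual $X^*$ and $0<p<\infty$, $\ell_p(X)$ is the space of sequences $(x_j)$ in $X$ with $\sum_j\|x_j\|^p<\infty$, and $\ell_p^w(X)$ is the space of sequences $(x_j)$ in $X$ with $\sup_{\varphi\in B_{X^*}}\sum_j|\varphi(x_j)|^p<\infty$. If $0<p,q_1,\dots,q_n<\infty$ and $\frac1p\le\frac1{q_1}+\cdots+\frac1{q_n}$, a continuous $n$-linear operator $T:X_1\times\cdots\times X_n\to Y$ is absolutely $(p;q_1,\dots,q_n)$-summing, written $T\in\Pi_{(p;q_1,\dots,q_n)}^n(X_1,\dots,X_n;Y)$, if $(T(x_j^{(1)},\dots,x_j^{(n)}))_{j=1}^\infty\in\ell_p(Y)$ for all $(x_j^{(k)})_{j=1}^\infty\in\ell_{q_k}^w(X_k)$,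 $k=1,\dots,n$. In the symbol $(s;s,t,\dots,t)$ the first variable has index $s$ and the remaining $n-1$ variables have index $t$, and similarly for the other symbols. *)

theory Defs
  imports "HOL-Analysis.Analysis"
begin

text \<open>
  The scalar field: a normed field that is isometrically isomorphic to the real or to the
  complex numbers.
\<close>

class real_or_complex = real_normed_field +
  assumes real_or_complex:
    "\<exists>f :: 'a \<Rightarrow> complex.
       (\<forall>x y. f (x + y) = f x + f y) \<and> (\<forall>x y. f (x * y) = f x * f y) \<and>
       (\<forall>x. cmod (f x) = norm x) \<and> (range f = \<real> \<or> range f = UNIV)"

instance real :: real_or_complex
  by standard (rule exI[of _ complex_of_real], auto simp: Reals_def)

instance complex :: real_or_complex
  by standard (rule exI[of _ "\<lambda>z. z"], auto)

text \<open>
  The type classes of the library only cover real normed spaces; the multiplication by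
  scalars from \<open>'k\<close> is therefore a separate parameter. For \<open>'k = real\<close> it is
  necessarily \<^const>\<open>scaleR\<close>.
\<close>

locale normed_space_over = vector_space sc
  for sc :: "'k::real_or_complex \<Rightarrow> 'a::real_normed_vector \<Rightarrow> 'a" +
  assumes sc_of_real: "sc (of_real r) x = r *\<^sub>R x"
    and norm_sc: "norm (sc c x) = norm c * norm x"

text \<open>
  A family \<open>X\<^sub>1, \<dots>, X\<^sub>n\<close> of Banach spaces is represented by complete linear subspaces of one
  normed space, each with the inherited norm. This loses no generality: arbitrary Banach
  spaces are (isometrically) the coordinate subspaces of their direct sum, and for
  spaces given by types that direct sum is the product type.
\<close>

definition banach_subspace ::
    "('k::real_or_complex \<Rightarrow> 'a::real_normed_vector \<Rightarrow> 'a) \<Rightarrow> 'a set \<Rightarrow> bool" where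
  "banach_subspace sc X \<longleftrightarrow> module.subspace sc X \<and> complete X"

text \<open>
  The closed unit ball of the dual of \<open>X\<close>. Functionals only matter on \<open>X\<close>; their values
  elsewhere are arbitrary.
\<close>

definition dual_ball ::
    "('k::real_or_complex \<Rightarrow> 'a::real_normed_vector \<Rightarrow> 'a) \<Rightarrow> 'a set \<Rightarrow> ('a \<Rightarrow> 'k) set" where
  "dual_ball sc X =
     {\<phi>. (\<forall>x\<in>X. \<forall>y\<in>X. \<phi> (x + y) = \<phi> x + \<phi> y) \<and>
          (\<forall>c. \<forall>x\<in>X. \<phi> (sc c x) = c * \<phi> x) \<and>
          (\<forall>x\<in>X. norm (\<phi> x) \<le> norm x)}"

definition lp_strong :: "real \<Rightarrow> (nat \<Rightarrow> 'a::real_normed_vector) set" where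
  "lp_strong p = {x. summable (\<lambda>j. norm (x j) powr p)}"

definition lp_weak ::
    "('k::real_or_complex \<Rightarrow> 'a::real_normed_vector \<Rightarrow> 'a) \<Rightarrow> real \<Rightarrow> 'a set \<Rightarrow> (nat \<Rightarrow> 'a) set" where
  "lp_weak sc p X =
     {x. (\<forall>j. x j \<in> X) \<and>
         (SUP \<phi>\<in>dual_ball sc X. \<Sum>j. ennreal (norm (\<phi> (x j)) powr p)) < \<infinity>}"

text \<open>
  Continuous multilinear maps on \<open>X\<^sub>1 \<times> \<dots> \<times> X\<^sub>n\<close>. A point of the product is a function in
  \<^term>\<open>PiE {1..n} X\<close>; its coordinates outside \<^term>\<open>{1..n}\<close> are fixed, so the topology
  of pointwise convergence on this set is the product topology.
\<close>

definition continuous_multilinear ::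
    "('k::real_or_complex \<Rightarrow> 'a::real_normed_vector \<Rightarrow> 'a) \<Rightarrow>
     ('k \<Rightarrow> 'z::real_normed_vector \<Rightarrow> 'z) \<Rightarrow>
     nat \<Rightarrow> (nat \<Rightarrow> 'a set) \<Rightarrow> ((nat \<Rightarrow> 'a) \<Rightarrow> 'z) set" where
  "continuous_multilinear scaleX scaleZ n X =
     {T. (\<forall>x\<in>PiE {1..n} X. \<forall>k\<in>{1..n}. \<forall>u\<in>X k. \<forall>v\<in>X k.
            T (x(k := u + v)) = T (x(k := u)) + T (x(k := v))) \<and>
         (\<forall>x\<in>PiE {1..n} X. \<forall>k\<in>{1..n}. \<forall>u\<in>X k. \<forall>c.
            T (x(k := scaleX c u)) = scaleZ c (T (x(k := u)))) \<and>
         continuous_on (PiE {1..n} X) T}"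

text \<open>The class of absolutely \<open>(p; q\<^sub>1, \<dots>, q\<^sub>n)\<close>-summing operators.\<close>

definition abs_summing ::
    "('k::real_or_complex \<Rightarrow> 'a::real_normed_vector \<Rightarrow> 'a) \<Rightarrow>
     ('k \<Rightarrow> 'z::real_normed_vector \<Rightarrow> 'z) \<Rightarrow>
     nat \<Rightarrow> (nat \<Rightarrow> 'a set) \<Rightarrow> real \<Rightarrow> (nat \<Rightarrow> real) \<Rightarrow> ((nat \<Rightarrow> 'a) \<Rightarrow> 'z) set" where
  "abs_summing scaleX scaleZ n X p q =
     {T \<in> continuous_multilinear scaleX scaleZ n X.
        0 < p \<and> (\<forall>k\<in>{1..n}. 0 < q k) \<and> 1 / p \<le> (\<Sum>k=1..n. 1 / q k) \<and>
        (\<forall>x. (\<forall>k\<in>{1..n}. x k \<in> lp_weak scaleX (q k) (X k)) \<longrightarrow>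
             (\<lambda>j. T (\<lambda>k\<in>{1..n}. x k j)) \<in> lp_strong p)}"

text \<open>
  The second moment of a Rademacher sum with \<open>m\<close> summands: the mean over all
  \<open>2\<^sup>m\<close> choices of signs.
\<close>

definition rademacher_mean_square :: "nat \<Rightarrow> (nat \<Rightarrow> 'a::real_normed_vector) \<Rightarrow> real" where
  "rademacher_mean_square m x =
     (\<Sum>\<epsilon>\<in>PiE {..<m} (\<lambda>_. {-1, 1}). (norm (\<Sum>j<m. \<epsilon> j *\<^sub>R x j))\<^sup>2) / 2 ^ m"

definition has_cotype :: "real \<Rightarrow> 'a::real_normed_vector set \<Rightarrow> bool" where
  "has_cotype q X \<longleftrightarrow>
     (\<exists>C\<ge>0. \<forall>m x. (\<forall>j<m. x j \<in> X) \<longrightarrow>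
        (\<Sum>j<m. norm (x j) powr q) powr (1 / q) \<le> C * sqrt (rademacher_mean_square m x))"

end

theory Submission
  imports Defs "HOL-Complex_Analysis.Great_Picard"
begin

text \<open>
  Everything rests on a factorization of weakly summable sequences in a space \<open>X\<close> of cotype 2:
  if \<open>1 \<le> p \<le> s \<le> 2\<close>, each weakly \<open>p\<close>-summable \<open>x\<close> can be written
  \<open>x\<^sub>j = \<lambda>\<^sub>j y\<^sub>j\<close> with \<open>\<lambda> \<in> \<ell>\<^sub>r\<close>, \<open>1/r = 1/p - 1/s\<close> (\<open>r = \<infinity>\<close> if \<open>p = s\<close>), and \<open>y\<close> weakly \<open>s\<close>-summable
  (\<open>lp_weak_factorization\<close>). By linearity in the first variable,
  \<open>T(x\<^sub>j, \<dots>) = \<lambda>\<^sub>j T(y\<^sub>j, \<dots>)\<close>; the values \<open>T(y\<^sub>j, \<dots>)\<close> form a sequence in \<open>\<ell>\<^sub>s\<close> by hypothesis, so the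
  products form a sequence in \<open>\<ell>\<^sub>p\<close> by Hoelder's inequality. The last inclusion of the theorem
  only needs that weak summability gets weaker as the exponent grows.

  It suffices to find \<open>d\<^sub>j > 0\<close> with \<open>\<Sum> d\<^sub>j < \<infinity>\<close> and
  \<open>\<Sum> |\<phi>(x\<^sub>j)|\<^sup>2 d\<^sub>j\<^bsup>1 - 2/p\<^esup> \<le> K\<close> for every \<open>\<phi>\<close> in the dual ball: then \<open>\<lambda>\<^sub>j = d\<^sub>j\<^bsup>1/r\<^esup>\<close> works for
  all \<open>s\<close> at once. Such weights come from a variational principle that replaces the usual
  separation argument of Pietsch and Maurey. Let \<open>A\<close> range over the convex hull of the vectors
  \<open>(|\<phi>(x\<^sub>j)|\<^sup>2)\<^sub>j\<close> and maximize the concave function \<open>\<Sum> A\<^sub>j\<^bsup>p/2\<^esup>\<close>: the first-order condition at a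
  maximum says exactly that \<open>\<Sum> |\<phi>(x\<^sub>j)|\<^sup>2 A\<^sub>j\<^bsup>p/2 - 1\<^esup> \<le> \<Sum> A\<^sub>j\<^bsup>p/2\<^esup>\<close> for all \<open>\<phi>\<close>, so
  \<open>d\<^sub>j = A\<^sub>j\<^bsup>p/2\<^esup>\<close> has the second property. An approximate maximum gives it up to a factor
  (\<open>near_maximizer_of_powr_sum\<close>).

  What remains is a bound for the maximum \<open>S\<close> that does not depend on the number of terms, and here
  cotype 2 enters. If \<open>A\<^sub>j = \<Sum>\<^sub>i w\<^sub>i |\<phi>\<^sub>i(x\<^sub>j)|\<^sup>2\<close>, then \<open>S\<close> is a sum of values \<open>\<phi>\<^sub>i(z\<^sub>i)\<close> for suitable
  combinations \<open>z\<^sub>i\<close> of the \<open>x\<^sub>j\<close>, and cotype 2 bounds \<open>\<Sum> \<parallel>z\<^sub>i\<parallel>\<^sup>2\<close> by the mean of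
  \<open>\<parallel>\<Sum> \<epsilon>\<^sub>i z\<^sub>i\<parallel>\<^sup>2\<close>. The norm of a combination \<open>\<Sum> b\<^sub>j x\<^sub>j\<close> is estimated in two ways: coefficients of
  moderate size are controlled by the weak \<open>p\<close>-norm of \<open>x\<close>, large ones by the first-order condition,
  with a small constant since large values of a Rademacher sum are rare (its fourth
  moment is at most 3 times the square of its second moment). The outcome is
  \<open>S\<^sup>2 \<le> const * S\<^bsup>2 - 2/p\<^esup> + S\<^sup>2/2\<close> up to harmless terms, so \<open>S\<close> is bounded
  (\<open>square_mean_bound\<close>, \<open>weights_for_finite_sections\<close>). For \<open>p = 1\<close> this is Maurey's theorem that
  operators from \<open>c\<^sub>0\<close> into a space of cotype 2 are 2-summing, and the same argument covers all
  \<open>p\<close> in \<open>[1, 2]\<close>.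

  Passing from bounds on functionals to bounds on norms takes the Hahn-Banach theorem over the real
  or complex field, which is proved first for real scalars.
\<close>

section \<open>The scalar field and Rademacher sums of scalars\<close>

text \<open>
  A multiplicative isometry fixes each real number \<open>r\<close>: its value there has distance \<open>|r|\<close> from 0
  and \<open>|r - 1|\<close> from 1, and \<open>r\<close> is the only complex number with these distances.
\<close>
lemma real_or_complex_embedding:
  obtains f :: "'k::real_or_complex \<Rightarrow> complex"
  where "\<And>x y. f (x + y) = f x + f y" and "\<And>x y. f (x * y) = f x * f y"
    and "\<And>x. cmod (f x) = norm x" and "\<And>r. f (of_real r) = of_real r"
    and "range f = \<real> \<or> range f = UNIV"
proof -
  obtain f :: "'k \<Rightarrow> complex" where add: "\<And>x y. f (x + y) = f x + f y"
    and mult: "\<And>x y. f (x * y) = f x * f y"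
    and nrm: "\<And>x. cmod (f x) = norm x" and rng: "range f = \<real> \<or> range f = UNIV"
    using real_or_complex[where 'a='k] by blast
  have "f 1 * f 1 = f 1 * 1" using mult[of 1 1] by simp
  moreover have "f 1 \<noteq> 0" using nrm[of 1] by auto
  ultimately have one: "f 1 = 1" by simp
  have diff: "f (x - y) = f x - f y" for x y using add[of "x - y" y] by simp
  have "f (of_real r) = of_real r" for r
  proof -
    let ?w = "f (of_real r)"
    have 1: "cmod ?w = \<bar>r\<bar>" using nrm[of "of_real r"] by simp
    have "cmod (?w - 1) = \<bar>r - 1\<bar>"
      using nrm[of "of_real r - 1"] norm_of_real[of "r - 1", where 'a='k] by (simp add: diff one)
    then have "(Re ?w - 1)\<^sup>2 + (Im ?w)\<^sup>2 = (r - 1)\<^sup>2"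
      by (metis cmod_power2 minus_complex.sel one_complex.sel diff_zero power2_abs)
    moreover have a: "(Re ?w)\<^sup>2 + (Im ?w)\<^sup>2 = r\<^sup>2" using 1 by (metis cmod_power2 power2_abs)
    ultimately have re: "Re ?w = r" by (simp add: power2_eq_square algebra_simps)
    then have "Im ?w = 0" using a by simp
    then show ?thesis using re by (simp add: complex_eq_iff)
  qed
  then show ?thesis using that add mult nrm rng by blast
qed

text \<open>Both facts hold in every inner product space; the scalars form one via the embedding.\<close>
lemma norm_add_diff_powers:
  fixes a b :: "'k::real_or_complex"
  shows "norm (a + b) ^ 4 + norm (a - b) ^ 4 \<le> 2 * norm a ^ 4 + 12 * (norm a)\<^sup>2 * (norm b)\<^sup>2 + 2 * norm b ^ 4"
    and "(norm (a + b))\<^sup>2 + (norm (a - b))\<^sup>2 = 2 * (norm a)\<^sup>2 + 2 * (norm b)\<^sup>2"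
proof -
  obtain f :: "'k \<Rightarrow> complex" where add: "\<And>x y. f (x + y) = f x + f y" and nrm: "\<And>x. cmod (f x) = norm x"
    using real_or_complex_embedding by metis
  have diff: "f (x - y) = f x - f y" for x y using add[of "x - y" y] by simp
  let ?u = "(norm a)\<^sup>2 + (norm b)\<^sup>2" and ?c = "2 * (f a \<bullet> f b)"
  have p: "(norm (a + b))\<^sup>2 = ?u + ?c"
    by (simp flip: nrm add: add power2_norm_eq_inner inner_simps inner_commute)
  have m: "(norm (a - b))\<^sup>2 = ?u - ?c"
    by (simp flip: nrm add: diff power2_norm_eq_inner inner_simps inner_commute)
  show "(norm (a + b))\<^sup>2 + (norm (a - b))\<^sup>2 = 2 * (norm a)\<^sup>2 + 2 * (norm b)\<^sup>2" using p m by simp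
  have c: "?c\<^sup>2 \<le> 4 * ((norm a)\<^sup>2 * (norm b)\<^sup>2)"
  proof -
    have "\<bar>f a \<bullet> f b\<bar> \<le> norm a * norm b" using Cauchy_Schwarz_ineq2[of "f a" "f b"] by (simp add: nrm)
    then have "\<bar>f a \<bullet> f b\<bar>\<^sup>2 \<le> (norm a * norm b)\<^sup>2" by (intro power_mono) auto
    then show ?thesis by (simp add: power_mult_distrib)
  qed
  have "norm (a + b) ^ 4 + norm (a - b) ^ 4 = (?u + ?c)\<^sup>2 + (?u - ?c)\<^sup>2"
    unfolding p[symmetric] m[symmetric] by simp
  also have "\<dots> = 2 * ?u\<^sup>2 + 2 * ?c\<^sup>2" by (simp add: power2_eq_square algebra_simps)
  also have "\<dots> \<le> 2 * ?u\<^sup>2 + 8 * ((norm a)\<^sup>2 * (norm b)\<^sup>2)" using c by simp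
  also have "\<dots> = 2 * norm a ^ 4 + 12 * (norm a)\<^sup>2 * (norm b)\<^sup>2 + 2 * norm b ^ 4"
    by (simp add: power2_eq_square power4_eq_xxxx algebra_simps)
  finally show "norm (a + b) ^ 4 + norm (a - b) ^ 4 \<le> 2 * norm a ^ 4 + 12 * (norm a)\<^sup>2 * (norm b)\<^sup>2 + 2 * norm b ^ 4" .
qed

abbreviation signs :: "nat \<Rightarrow> (nat \<Rightarrow> real) set" where
  "signs N \<equiv> PiE {..<N} (\<lambda>_. {-1, 1})"

lemma sum_signs_Suc:
  "(\<Sum>\<epsilon>\<in>signs (Suc N). h \<epsilon>) = (\<Sum>\<epsilon>\<in>signs N. h (\<epsilon>(N := 1)) + h (\<epsilon>(N := -1)))"
  for h :: "(nat \<Rightarrow> real) \<Rightarrow> real"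
proof -
  have inj: "inj_on (\<lambda>p. (snd p)(N := fst p)) ({-1, 1::real} \<times> signs N)"
    using inj_combinator[of N "{..<N}" "\<lambda>_. {-1, 1::real}"] by (simp add: case_prod_unfold)
  have "signs (Suc N) = (\<lambda>p. (snd p)(N := fst p)) ` ({-1, 1} \<times> signs N)"
    unfolding lessThan_Suc PiE_insert_eq case_prod_unfold by simp
  then have "(\<Sum>\<epsilon>\<in>signs (Suc N). h \<epsilon>) = (\<Sum>(y, g)\<in>{-1, 1} \<times> signs N. h (g(N := y)))"
    by (simp only: sum.reindex[OF inj] comp_def case_prod_unfold)
  also have "\<dots> = (\<Sum>y\<in>{-1, 1}. \<Sum>g\<in>signs N. h (g(N := y)))"
    by (simp add: sum.cartesian_product)
  also have "\<dots> = (\<Sum>\<epsilon>\<in>signs N. h (\<epsilon>(N := 1)) + h (\<epsilon>(N := -1)))"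
    by (simp add: sum.distrib)
  finally show ?thesis .
qed

lemma signed_sum_fun_upd:
  "(\<Sum>i<Suc N. (\<epsilon>(N := y)) i *\<^sub>R v i) = (\<Sum>i<N. \<epsilon> i *\<^sub>R v i) + y *\<^sub>R v N"
  for v :: "nat \<Rightarrow> 'v::real_vector"
proof -
  have "(\<Sum>i<N. (\<epsilon>(N := y)) i *\<^sub>R v i) = (\<Sum>i<N. \<epsilon> i *\<^sub>R v i)"
    by (rule sum.cong) auto
  then show ?thesis by simp
qed

lemma card_signs: "card (signs N) = 2 ^ N"
  by (simp add: card_PiE numeral_2_eq_2)

lemma sum_signs_square:
  fixes v :: "nat \<Rightarrow> 'k::real_or_complex"
  shows "(\<Sum>\<epsilon>\<in>signs N. (norm (\<Sum>i<N. \<epsilon> i *\<^sub>R v i))\<^sup>2) = 2 ^ N * (\<Sum>i<N. (norm (v i))\<^sup>2)"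
proof (induction N)
  case (Suc N)
  have "(\<Sum>\<epsilon>\<in>signs (Suc N). (norm (\<Sum>i<Suc N. \<epsilon> i *\<^sub>R v i))\<^sup>2)
      = (\<Sum>\<epsilon>\<in>signs N. 2 * (norm (\<Sum>i<N. \<epsilon> i *\<^sub>R v i))\<^sup>2 + 2 * (norm (v N))\<^sup>2)"
    unfolding sum_signs_Suc signed_sum_fun_upd
    by (rule sum.cong) (simp_all add: norm_add_diff_powers(2))
  also have "\<dots> = 2 ^ Suc N * (\<Sum>i<Suc N. (norm (v i))\<^sup>2)"
    by (simp add: sum.distrib card_signs algebra_simps flip: sum_distrib_left Suc.IH)
  finally show ?case .
qed simp

text \<open>
  The Khintchine inequality for the fourth moment, with its optimal constant 3. Adding one
  summand of norm \<open>b\<close> to a sum with mean square \<open>s\<close> raises the fourth moment by at most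
  \<open>6 s b\<^sup>2 + b\<^sup>4\<close>, and \<open>3 s\<^sup>2 + 6 s b\<^sup>2 + b\<^sup>4 \<le> 3 (s + b\<^sup>2)\<^sup>2\<close>.
\<close>
lemma sum_signs_fourth:
  fixes v :: "nat \<Rightarrow> 'k::real_or_complex"
  shows "(\<Sum>\<epsilon>\<in>signs N. norm (\<Sum>i<N. \<epsilon> i *\<^sub>R v i) ^ 4) \<le> 2 ^ N * (3 * (\<Sum>i<N. (norm (v i))\<^sup>2)\<^sup>2)"
proof (induction N)
  case (Suc N)
  let ?F = "\<lambda>\<epsilon>. norm (\<Sum>i<N. \<epsilon> i *\<^sub>R v i)" and ?b = "norm (v N)"
  let ?s = "\<Sum>i<N. (norm (v i))\<^sup>2"
  have "(\<Sum>\<epsilon>\<in>signs (Suc N). norm (\<Sum>i<Suc N. \<epsilon> i *\<^sub>R v i) ^ 4)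
      \<le> (\<Sum>\<epsilon>\<in>signs N. 2 * ?F \<epsilon> ^ 4 + 12 * (?F \<epsilon>)\<^sup>2 * ?b\<^sup>2 + 2 * ?b ^ 4)"
    unfolding sum_signs_Suc signed_sum_fun_upd
    by (rule sum_mono) (use norm_add_diff_powers(1) in auto)
  also have "\<dots> = 2 * (\<Sum>\<epsilon>\<in>signs N. ?F \<epsilon> ^ 4) + 12 * ?b\<^sup>2 * (\<Sum>\<epsilon>\<in>signs N. (?F \<epsilon>)\<^sup>2) + 2 ^ N * (2 * ?b ^ 4)"
    by (simp add: sum.distrib card_signs sum_distrib_left mult_ac)
  also have "\<dots> \<le> 2 * (2 ^ N * (3 * ?s\<^sup>2)) + 12 * ?b\<^sup>2 * (2 ^ N * ?s) + 2 ^ N * (2 * ?b ^ 4)"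
    using Suc.IH by (simp add: sum_signs_square)
  also have "\<dots> \<le> 2 ^ Suc N * (3 * (?s + ?b\<^sup>2)\<^sup>2)"
  proof -
    have "2 ^ Suc N * (3 * (?s + ?b\<^sup>2)\<^sup>2)
      = 2 * (2 ^ N * (3 * ?s\<^sup>2)) + 12 * ?b\<^sup>2 * (2 ^ N * ?s) + 2 ^ N * (6 * ?b ^ 4)"
      by (simp add: power2_eq_square power4_eq_xxxx algebra_simps)
    moreover have "(2::real) ^ N * (2 * ?b ^ 4) \<le> 2 ^ N * (6 * ?b ^ 4)" by simp
    ultimately show ?thesis by linarith
  qed
  finally show ?case by simp
qed simp

section \<open>Norming functionals\<close>

text \<open>
  The Hahn-Banach theorem is obtained from minimal sublinear functionals: sublinear functionals
  dominated by the norm have minimal elements by Zorn's lemma, and minimal ones are linear.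
\<close>
definition sublinear_below_norm :: "('a::real_normed_vector \<Rightarrow> real) \<Rightarrow> bool" where
  "sublinear_below_norm q \<longleftrightarrow> (\<forall>x y. q (x + y) \<le> q x + q y) \<and> (\<forall>r>0. \<forall>x. q (r *\<^sub>R x) = r * q x) \<and> (\<forall>x. q x \<le> norm x)"

lemma sublinear_below_normD:
  assumes "sublinear_below_norm q"
  shows "q (x + y) \<le> q x + q y" "r \<ge> 0 \<Longrightarrow> q (r *\<^sub>R x) = r * q x" "q x \<le> norm x" "- norm x \<le> q x" "q 0 = 0"
proof -
  have "q (2 *\<^sub>R 0) = 2 * q 0" using assms unfolding sublinear_below_norm_def by (metis zero_less_numeral)
  then show z: "q 0 = 0" by simp
  show a: "q (x + y) \<le> q x + q y" for x y using assms by (simp add: sublinear_below_norm_def)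
  show "r \<ge> 0 \<Longrightarrow> q (r *\<^sub>R x) = r * q x"
    using assms z by (cases "r = 0") (auto simp: sublinear_below_norm_def)
  show b: "q x \<le> norm x" for x using assms by (simp add: sublinear_below_norm_def)
  show "- norm x \<le> q x" using a[of x "-x"] b[of "-x"] z by simp
qed

text \<open>
  The device that makes \<open>q\<close> smaller in the direction of \<open>- y\<close>. It stays sublinear and satisfies
  \<open>slide q y (- y) \<le> - q y\<close>. A minimal \<open>q\<close> coincides with all its slides, which makes it odd
  and therefore linear.
\<close>
definition slide :: "('a::real_normed_vector \<Rightarrow> real) \<Rightarrow> 'a \<Rightarrow> 'a \<Rightarrow> real" where
  "slide q y x = (INF t\<in>{0..}. q (x + t *\<^sub>R y) - t * q y)"

lemma slide_bound:
  assumes q: "sublinear_below_norm q"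
  shows "bdd_below ((\<lambda>t. q (x + t *\<^sub>R y) - t * q y) ` {0..})"
proof (intro bdd_belowI2)
  fix t :: real assume t: "t \<in> {0..}"
  have "t * q y = q ((x + t *\<^sub>R y) + (- x))" using sublinear_below_normD(2)[OF q, of t y] t by simp
  also have "\<dots> \<le> q (x + t *\<^sub>R y) + norm x"
    using sublinear_below_normD(1)[OF q, of "x + t *\<^sub>R y" "-x"] sublinear_below_normD(3)[OF q, of "-x"] by simp
  finally show "- norm x \<le> q (x + t *\<^sub>R y) - t * q y" by simp
qed

lemma slide_le: "sublinear_below_norm q \<Longrightarrow> t \<ge> 0 \<Longrightarrow> slide q y x \<le> q (x + t *\<^sub>R y) - t * q y"
  unfolding slide_def by (rule cINF_lower[OF slide_bound]) auto

lemma slide_le_self: "sublinear_below_norm q \<Longrightarrow> slide q y x \<le> q x"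
  using slide_le[of q 0 y x] by simp

lemma slide_neg: "sublinear_below_norm q \<Longrightarrow> slide q y (- y) \<le> - q y"
  using slide_le[of q 1 y "- y"] by (simp add: sublinear_below_normD(5))

lemma slide_greatest:
  "(\<And>t. t \<ge> 0 \<Longrightarrow> c \<le> q (x + t *\<^sub>R y) - t * q y) \<Longrightarrow> c \<le> slide q y x"
  unfolding slide_def by (rule cINF_greatest) auto

lemma sublinear_slide:
  assumes q: "sublinear_below_norm q"
  shows "sublinear_below_norm (slide q y)"
  unfolding sublinear_below_norm_def
proof (intro conjI allI impI)
  fix x z
  have *: "slide q y (x + z) \<le> (q (x + t *\<^sub>R y) - t * q y) + (q (z + u *\<^sub>R y) - u * q y)"
    if "t \<ge> 0" "u \<ge> 0" for t u
  proof -
    have "slide q y (x + z) \<le> q ((x + z) + (t + u) *\<^sub>R y) - (t + u) * q y"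
      using slide_le[OF q] that by simp
    also have "(x + z) + (t + u) *\<^sub>R y = (x + t *\<^sub>R y) + (z + u *\<^sub>R y)"
      by (simp add: algebra_simps)
    finally show ?thesis using sublinear_below_normD(1)[OF q, of "x + t *\<^sub>R y" "z + u *\<^sub>R y"]
      by (simp add: algebra_simps)
  qed
  have "slide q y (x + z) - (q (x + t *\<^sub>R y) - t * q y) \<le> slide q y z" if "t \<ge> 0" for t
    by (rule slide_greatest) (use *[OF that] in \<open>simp add: algebra_simps\<close>)
  then have "slide q y (x + z) - slide q y z \<le> slide q y x"
    by (intro slide_greatest) (simp add: algebra_simps)
  then show "slide q y (x + z) \<le> slide q y x + slide q y z" by simp
next
  fix r :: real and x assume r: "r > 0"
  have le: "slide q y (r *\<^sub>R x) \<le> r * slide q y x" if r: "r > 0" for r :: real and x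
  proof -
    have "slide q y (r *\<^sub>R x) / r \<le> slide q y x"
    proof (rule slide_greatest)
      fix t :: real assume t: "t \<ge> 0"
      have "slide q y (r *\<^sub>R x) \<le> q (r *\<^sub>R x + (r * t) *\<^sub>R y) - (r * t) * q y"
        using slide_le[OF q] t r by simp
      also have "r *\<^sub>R x + (r * t) *\<^sub>R y = r *\<^sub>R (x + t *\<^sub>R y)" by (simp add: algebra_simps)
      also have "q \<dots> = r * q (x + t *\<^sub>R y)" using sublinear_below_normD(2)[OF q] r by simp
      finally show "slide q y (r *\<^sub>R x) / r \<le> q (x + t *\<^sub>R y) - t * q y"
        using r by (simp add: field_simps)
    qed
    then show ?thesis using r by (simp add: field_simps)
  qed
  have "slide q y x \<le> inverse r * slide q y (r *\<^sub>R x)"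
    using le[of "inverse r" "r *\<^sub>R x"] r by simp
  then have "r * slide q y x \<le> slide q y (r *\<^sub>R x)" using r by (simp add: field_simps)
  with le[OF r] show "slide q y (r *\<^sub>R x) = r * slide q y x" by (rule antisym)
next
  fix x show "slide q y x \<le> norm x"
    using slide_le_self[OF q, of y x] sublinear_below_normD(3)[OF q, of x] by simp
qed

lemma sublinear_Inf_chain:
  assumes ne: "C \<noteq> {}" and sub: "\<And>q. q \<in> C \<Longrightarrow> sublinear_below_norm q"
    and chain: "\<And>q q'. q \<in> C \<Longrightarrow> q' \<in> C \<Longrightarrow> q \<le> q' \<or> q' \<le> q"
  shows "sublinear_below_norm (\<lambda>x. INF q\<in>C. q x)" and "\<And>q x. q \<in> C \<Longrightarrow> (INF q\<in>C. q x) \<le> q x"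
proof -
  have bdd: "bdd_below ((\<lambda>q. q x) ` C)" for x
    by (rule bdd_belowI2[of _ "- norm x"]) (use sublinear_below_normD(4) sub in blast)
  show low: "(INF q\<in>C. q x) \<le> q x" if "q \<in> C" for q x
    by (rule cINF_lower[OF bdd that])
  show "sublinear_below_norm (\<lambda>x. INF q\<in>C. q x)"
    unfolding sublinear_below_norm_def
  proof (intro conjI allI impI)
    fix x y
    have *: "(INF q\<in>C. q (x + y)) \<le> q x + q' y" if qq: "q \<in> C" "q' \<in> C" for q q'
    proof -
      obtain r where "r \<in> C" "r \<le> q" "r \<le> q'" using chain[OF qq] qq by blast
      then show ?thesis
        using low[of r "x + y"] sublinear_below_normD(1)[OF sub[of r], of x y] le_funD[of r q x] le_funD[of r q' y]
        by simp
    qed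
    have "(INF q\<in>C. q (x + y)) - q x \<le> (INF q\<in>C. q y)" if "q \<in> C" for q
      by (rule cINF_greatest[OF ne]) (use *[OF that] in \<open>simp add: algebra_simps\<close>)
    then have "(INF q\<in>C. q (x + y)) - (INF q\<in>C. q y) \<le> (INF q\<in>C. q x)"
      by (intro cINF_greatest[OF ne]) (simp add: algebra_simps)
    then show "(INF q\<in>C. q (x + y)) \<le> (INF q\<in>C. q x) + (INF q\<in>C. q y)" by simp
  next
    fix r :: real and x assume r: "r > 0"
    have le: "(INF q\<in>C. q (r *\<^sub>R x)) \<le> r * (INF q\<in>C. q x)" if r: "r > 0" for r :: real and x
    proof -
      have "(INF q\<in>C. q (r *\<^sub>R x)) / r \<le> (INF q\<in>C. q x)"
      proof (rule cINF_greatest[OF ne])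
        fix q assume "q \<in> C"
        then show "(INF q\<in>C. q (r *\<^sub>R x)) / r \<le> q x"
          using low[of q "r *\<^sub>R x"] sublinear_below_normD(2)[OF sub[of q], of r x] r by (simp add: field_simps)
      qed
      then show ?thesis using r by (simp add: field_simps)
    qed
    have "(INF q\<in>C. q x) \<le> inverse r * (INF q\<in>C. q (r *\<^sub>R x))"
      using le[of "inverse r" "r *\<^sub>R x"] r by simp
    then have "r * (INF q\<in>C. q x) \<le> (INF q\<in>C. q (r *\<^sub>R x))" using r by (simp add: field_simps)
    with le[OF r] show "(INF q\<in>C. q (r *\<^sub>R x)) = r * (INF q\<in>C. q x)" by (rule antisym)
  next
    fix x obtain q where "q \<in> C" using ne by blast
    then show "(INF q\<in>C. q x) \<le> norm x"
      using low[of q x] sublinear_below_normD(3)[OF sub[of q], of x] by simp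
  qed
qed

text \<open>
  Zorn's lemma is applied to the sublinear functionals with \<open>q (- v) \<le> - norm v\<close>. The norm
  slid along \<open>v\<close> belongs to this class, and a linear functional \<open>m \<le> norm\<close> in it satisfies
  \<open>m v = norm v\<close>.
\<close>
lemma real_norming_functional:
  fixes v :: "'a::real_normed_vector"
  obtains \<psi> :: "'a \<Rightarrow> real" where "linear \<psi>" "\<And>x. \<psi> x \<le> norm x" "\<psi> v = norm v"
proof -
  let ?A = "{q. sublinear_below_norm q \<and> q (- v) \<le> - norm v}"
  have norm_sub: "sublinear_below_norm (norm :: 'a \<Rightarrow> real)"
    by (auto simp: sublinear_below_norm_def norm_triangle_ineq)
  have q0: "slide norm v \<in> ?A" using sublinear_slide slide_neg norm_sub by blast
  have "\<exists>m\<in>?A. \<forall>q\<in>?A. m \<ge> q \<longrightarrow> q = m"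
  proof (rule predicate_Zorn)
    show "partial_order_on ?A (relation_of (\<ge>) ?A)"
      by (rule partial_order_on_relation_ofI) auto
  next
    fix C assume C: "C \<in> Chains (relation_of (\<ge>) ?A)"
    then have sub: "q \<in> C \<Longrightarrow> q \<in> ?A" and ch: "q \<in> C \<Longrightarrow> q' \<in> C \<Longrightarrow> q \<le> q' \<or> q' \<le> q" for q q'
      unfolding Chains_def relation_of_def by auto
    show "\<exists>u\<in>?A. \<forall>q\<in>C. q \<ge> u"
    proof (cases "C = {}")
      case True then show ?thesis using q0 by blast
    next
      case False
      then obtain q where q: "q \<in> C" by blast
      have s: "sublinear_below_norm (\<lambda>x. INF q\<in>C. q x)"
        by (rule sublinear_Inf_chain(1)) (use False sub ch in auto)
      have l: "(INF q\<in>C. q x) \<le> q x" if "q \<in> C" for q x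
        by (rule sublinear_Inf_chain(2)) (use False sub ch that in auto)
      show ?thesis
        by (rule bexI[of _ "\<lambda>x. INF q\<in>C. q x"])
          (use s l sub q order_trans[OF l[OF q, of "- v"]] in \<open>auto simp: le_fun_def\<close>)
    qed
  qed
  then obtain m where m: "sublinear_below_norm m" "m (- v) \<le> - norm v"
    and min: "\<And>q. sublinear_below_norm q \<Longrightarrow> q (- v) \<le> - norm v \<Longrightarrow> q \<le> m \<Longrightarrow> q = m" by blast
  have slide_m: "slide m y = m" for y
    using slide_le_self[OF m(1)] m
    by (intro min sublinear_slide) (auto simp: le_fun_def intro: order_trans)
  have odd: "m (- y) = - m y" for y
  proof (rule antisym)
    show "m (- y) \<le> - m y" using slide_neg[OF m(1), of y] slide_m by simp
    show "- m y \<le> m (- y)" using sublinear_below_normD(1)[OF m(1), of y "- y"] sublinear_below_normD(5)[OF m(1)] by simp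
  qed
  have lin: "linear m"
  proof (rule linearI)
    fix x y
    have "m (- x + - y) \<le> m (- x) + m (- y)" by (rule sublinear_below_normD(1)[OF m(1)])
    then have "m x + m y \<le> m (x + y)" using odd[of "x + y"] by (simp add: odd)
    then show "m (x + y) = m x + m y" using sublinear_below_normD(1)[OF m(1), of x y] by simp
  next
    fix r x show "m (r *\<^sub>R x) = r *\<^sub>R m x"
    proof (cases "r \<ge> 0")
      case True then show ?thesis using sublinear_below_normD(2)[OF m(1)] by simp
    next
      case False
      then show ?thesis using sublinear_below_normD(2)[OF m(1), of "- r" x] odd[of "r *\<^sub>R x"] by simp
    qed
  qed
  have "m v = norm v" using m(2) odd[of v] sublinear_below_normD(3)[OF m(1), of v] by simp
  then show ?thesis using that lin sublinear_below_normD(3)[OF m(1)] by blast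
qed

text \<open>
  A real norming functional \<open>\<psi>\<close> is turned into one over the scalar field. If the field is
  complex this is the usual \<open>\<phi> x = \<psi> x - \<i> \<psi> (\<i> x)\<close>, whose real part is \<open>\<psi>\<close>.
\<close>
lemma norming_functional:
  fixes sc :: "'k::real_or_complex \<Rightarrow> 'a::real_normed_vector \<Rightarrow> 'a"
  assumes sc: "normed_space_over sc"
  obtains \<phi> where "\<phi> \<in> dual_ball sc X" and "norm v \<le> norm (\<phi> v)"
proof -
  interpret normed_space_over sc by (rule sc)
  obtain f :: "'k \<Rightarrow> complex" where add: "\<And>x y. f (x + y) = f x + f y"
    and mult: "\<And>x y. f (x * y) = f x * f y"
    and nrm: "\<And>x. cmod (f x) = norm x" and of_r: "\<And>r. f (of_real r) = of_real r"
    and rng: "range f = \<real> \<or> range f = UNIV"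
    using real_or_complex_embedding by metis
  have diff: "f (x - y) = f x - f y" for x y using add[of "x - y" y] by simp
  have inj: "x = y" if "f x = f y" for x y using nrm[of "x - y"] that by (simp add: diff)
  obtain \<psi> where \<psi>: "linear \<psi>" "\<And>x. \<psi> x \<le> norm x" "\<psi> v = norm v"
    using real_norming_functional[of v] by metis
  have \<psi>_add: "\<psi> (x + y) = \<psi> x + \<psi> y" and \<psi>_sc: "\<psi> (sc (of_real r) x) = r * \<psi> x" for x y r
    using \<psi>(1) by (simp_all add: linear_add linear_scale sc_of_real)
  obtain \<phi> where lin: "\<And>x y. \<phi> (x + y) = \<phi> x + \<phi> y" "\<And>c x. \<phi> (sc c x) = c * \<phi> x"
    and re: "\<And>x. Re (f (\<phi> x)) = \<psi> x"
    using rng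
  proof
    assume R: "range f = \<real>"
    have real: "\<exists>r. c = of_real r" for c :: 'k
    proof -
      have "f c \<in> \<real>" using R by auto
      then obtain r where "f c = of_real r" by (auto elim: Reals_cases)
      then show ?thesis using inj of_r by metis
    qed
    show ?thesis
    proof (rule that[of "\<lambda>x. of_real (\<psi> x)"])
      fix c x show "of_real (\<psi> (sc c x)) = c * (of_real (\<psi> x) :: 'k)"
        using real[of c] \<psi>_sc by auto
    qed (simp_all add: \<psi>_add of_r)
  next
    assume "range f = UNIV"
    then obtain I where I: "f I = \<i>" by (metis UNIV_I imageE)
    have II: "I * I = -1" using I mult of_r[of "-1"] by (intro inj) (simp add: mult)
    have II': "I * (I * z) = - z" for z using II by (simp flip: mult.assoc)
    have cart: "\<exists>a b. c = of_real a + of_real b * I" for c :: 'k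
    proof -
      have "f c = f (of_real (Re (f c)) + of_real (Im (f c)) * I)"
        by (simp add: add mult of_r I complex_eq mult.commute)
      then show ?thesis using inj by blast
    qed
    let ?\<phi> = "\<lambda>x. of_real (\<psi> x) - of_real (\<psi> (sc I x)) * I"
    show ?thesis
    proof (rule that[of ?\<phi>])
      fix c x
      obtain a b where c: "c = of_real a + of_real b * I" using cart by blast
      have 1: "sc c x = sc (of_real a) x + sc (of_real b) (sc I x)"
        by (simp add: c scale_left_distrib)
      have "I * c = of_real a * I + of_real (- b)"
        by (simp add: c algebra_simps II')
      then have 2: "sc I (sc c x) = sc (of_real a) (sc I x) + sc (of_real (- b)) x"
        by (simp add: scale_left_distrib del: of_real_minus)
      show "?\<phi> (sc c x) = c * ?\<phi> x"
        unfolding 2 unfolding 1 unfolding c \<psi>_add \<psi>_sc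
        by (simp add: algebra_simps II')
    next
      fix x show "Re (f (?\<phi> x)) = \<psi> x" by (simp add: diff mult of_r I)
    qed (simp add: \<psi>_add scale_right_distrib algebra_simps)
  qed
  have "norm (\<phi> x) \<le> norm x" for x
  proof (cases "\<phi> x = 0")
    case False
    \<comment> \<open>Rotating \<open>x\<close> makes the value of \<open>\<phi>\<close> real, hence equal to the value of \<open>\<psi>\<close>.\<close>
    let ?c = "of_real (norm (\<phi> x)) / \<phi> x"
    have "\<phi> (sc ?c x) = of_real (norm (\<phi> x))" using False by (simp add: lin)
    then have "norm (\<phi> x) = \<psi> (sc ?c x)" using re[of "sc ?c x"] of_r by simp
    also have "\<dots> \<le> norm x" using \<psi>(2)[of "sc ?c x"] False by (simp add: norm_sc norm_divide)
    finally show ?thesis .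
  qed simp
  then have "\<phi> \<in> dual_ball sc X" by (simp add: dual_ball_def lin)
  moreover have "norm v \<le> norm (\<phi> v)"
    using complex_Re_le_cmod[of "f (\<phi> v)"] by (simp add: re \<psi> nrm)
  ultimately show ?thesis using that by blast
qed

section \<open>Near maximizers of a concave power sum\<close>

text \<open>
  A crude form of Young's inequality, from which the instances of Hoelder's inequality below are
  obtained.
\<close>
lemma powr_product_le_sum:
  fixes u v :: real
  assumes "0 \<le> u" "0 \<le> v" "0 \<le> \<theta>" "\<theta> \<le> 1"
  shows "u powr \<theta> * v powr (1 - \<theta>) \<le> u + v"
proof (cases "u = 0 \<or> v = 0")
  case False
  then have "u powr \<theta> * v powr (1 - \<theta>) \<le> \<theta> * u + (1 - \<theta>) * v"
    using assms by (intro Youngs_inequality_0) auto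
  also have "\<dots> \<le> 1 * u + 1 * v" using assms by (intro add_mono mult_right_mono) auto
  finally show ?thesis by simp
qed (use assms in auto)

text \<open>The graph of the concave function \<open>u \<mapsto> u powr a\<close> lies below its tangent at \<open>v\<close>.\<close>
lemma powr_le_tangent:
  fixes u v :: real
  assumes "0 < u" "0 < v" "0 \<le> a" "a \<le> 1"
  shows "u powr a \<le> v powr a + a * v powr (a - 1) * (u - v)"
proof -
  have *: "u powr a * v powr (1 - a) \<le> a * u + (1 - a) * v"
    using assms by (intro Youngs_inequality_0) auto
  have "u powr a = (u powr a * v powr (1 - a)) * v powr (a - 1)"
    using assms by (simp flip: powr_add add: mult.assoc)
  also have "\<dots> \<le> (a * u + (1 - a) * v) * v powr (a - 1)"
    using * by (rule mult_right_mono) simp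
  also have "\<dots> = v * v powr (a - 1) + a * v powr (a - 1) * (u - v)"
    by (simp add: algebra_simps)
  also have "v * v powr (a - 1) = v powr a" using assms by (simp add: powr_mult_base)
  finally show ?thesis .
qed

text \<open>
  An approximate first-order condition. Let \<open>F A\<close> be the sum of the \<open>(A\<^sub>j + \<delta>\<^sub>j)\<^sup>a\<close>. At an exact
  maximizer, moving towards \<open>B\<close> would show that the derivative of \<open>F\<close> is not positive, which is
  the conclusion with 1 in place of 6. Suprema need not be attained, so a step of fixed length
  \<open>\<tau>\<close> is made from a point that is optimal up to \<open>\<eta>\<close>. The shift \<open>\<delta>\<close> keeps the bases away from
  0, where the derivative of the power is infinite.
\<close>
lemma near_maximizer_of_powr_sum:
  fixes K :: "(nat \<Rightarrow> real) set" and U \<delta> :: "nat \<Rightarrow> real"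
  assumes a: "0 < a" "a \<le> 1" and ne: "K \<noteq> {}"
    and nonneg: "\<And>A j. A \<in> K \<Longrightarrow> 0 \<le> A j"
    and bound: "\<And>A j. A \<in> K \<Longrightarrow> A j \<le> U j"
    and convex: "\<And>A B \<tau>. A \<in> K \<Longrightarrow> B \<in> K \<Longrightarrow> 0 \<le> \<tau> \<Longrightarrow> \<tau> \<le> 1 \<Longrightarrow> (\<lambda>j. (1 - \<tau>) * A j + \<tau> * B j) \<in> K"
    and \<delta>: "\<And>j. 0 < \<delta> j"
  obtains A where "A \<in> K"
    and "\<And>B. B \<in> K \<Longrightarrow> (\<Sum>j<m. B j * (A j + \<delta> j) powr (a - 1)) \<le> 6 * (\<Sum>j<m. (A j + \<delta> j) powr a)"
proof (cases "m = 0")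
  case True
  then show ?thesis using ne that by auto
next
  case False
  define F where "F A = (\<Sum>j<m. (A j + \<delta> j) powr a)" for A
  define S0 where "S0 = (\<Sum>j<m. \<delta> j powr a)"
  have S0: "S0 > 0" unfolding S0_def using False \<delta>
    by (intro sum_pos) (auto simp: less_le_trans dest: less_imp_neq[symmetric])
  have F_ge: "S0 \<le> F A" if "A \<in> K" for A
    unfolding S0_def F_def using a \<delta> nonneg[OF that]
    by (intro sum_mono powr_mono2) (auto simp: less_imp_le)
  have U0: "0 \<le> U j" for j using ne nonneg bound by (metis all_not_in_conv order_trans)
  \<comment> \<open>The step is so short that it changes each base at most by a factor between 1/2 and 2.\<close>
  define \<tau> where "\<tau> = 1 / (2 + (\<Sum>j<m. (U j + \<delta> j) / \<delta> j))"
  have pos: "0 \<le> (U j + \<delta> j) / \<delta> j" for j using U0[of j] \<delta>[of j] by simp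
  then have s0: "0 \<le> (\<Sum>j<m. (U j + \<delta> j) / \<delta> j)" by (intro sum_nonneg) auto
  have \<tau>: "0 < \<tau>" "\<tau> \<le> 1/2" using s0 by (auto simp: \<tau>_def field_simps)
  have \<tau>\<delta>: "\<tau> * (U j + \<delta> j) \<le> \<delta> j" if "j < m" for j
  proof -
    have "(U j + \<delta> j) / \<delta> j \<le> (\<Sum>j<m. (U j + \<delta> j) / \<delta> j)"
      using that pos by (intro member_le_sum) auto
    then have "(U j + \<delta> j) / \<delta> j \<le> 1 / \<tau>" by (simp add: \<tau>_def)
    then show ?thesis using \<delta>[of j] \<tau> by (simp add: field_simps)
  qed
  have "F A \<le> (\<Sum>j<m. (U j + \<delta> j) powr a)" if "A \<in> K" for A
    unfolding F_def using a \<delta> nonneg[OF that] bound[OF that]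
    by (intro sum_mono powr_mono2) (auto simp: less_imp_le add_nonneg_pos)
  then have bdd: "bdd_above (F ` K)" by (rule bdd_aboveI2)
  define \<eta> where "\<eta> = a * \<tau> * S0"
  have "Sup (F ` K) - \<eta> < Sup (F ` K)" using a \<tau> S0 by (simp add: \<eta>_def)
  then obtain A where A: "A \<in> K" "Sup (F ` K) - \<eta> < F A"
    using less_cSup_iff[OF _ bdd] ne by auto
  show ?thesis
  proof (rule that[OF A(1)])
    fix B assume B: "B \<in> K"
    define D E where "D j = A j + \<delta> j" and "E j = (1 - \<tau>) * A j + \<tau> * B j + \<delta> j" for j
    have Dpos: "D j > 0" for j using nonneg[OF A(1)] \<delta> by (simp add: D_def add_nonneg_pos)
    have "F (\<lambda>j. (1 - \<tau>) * A j + \<tau> * B j) \<le> Sup (F ` K)"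
      using A B \<tau> by (intro cSup_upper[OF _ bdd] imageI convex) auto
    then have FE: "(\<Sum>j<m. E j powr a) \<le> (\<Sum>j<m. D j powr a) + \<eta>"
      using A(2) by (simp add: F_def D_def E_def)
    have tangent: "a * \<tau> * (B j * D j powr (a - 1) / 2 - 2 * D j powr a) \<le> E j powr a - D j powr a"
      if j: "j < m" for j
    proof -
      have ED: "E j = D j + \<tau> * (B j - A j)" by (simp add: D_def E_def algebra_simps)
      have Eup: "E j \<le> 2 * D j"
      proof -
        have "\<tau> * B j \<le> \<tau> * (U j + \<delta> j)"
          using bound[OF B, of j] \<delta>[of j] \<tau> by (intro mult_left_mono) auto
        also have "\<dots> \<le> D j" using \<tau>\<delta>[OF j] nonneg[OF A(1), of j] by (simp add: D_def)
        finally have "\<tau> * B j \<le> D j" .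
        moreover have "0 \<le> \<tau> * A j" using nonneg[OF A(1), of j] \<tau> by simp
        ultimately show ?thesis by (simp add: ED algebra_simps)
      qed
      have Elo: "D j / 2 \<le> E j"
      proof -
        have "(1/2) * A j \<le> (1 - \<tau>) * A j"
          using \<tau> nonneg[OF A(1), of j] by (intro mult_right_mono) auto
        moreover have "0 \<le> \<tau> * B j" using nonneg[OF B, of j] \<tau> by simp
        ultimately show ?thesis using \<delta>[of j] by (simp add: E_def D_def)
      qed
      have Epos: "E j > 0" using Elo Dpos[of j] by simp
      have 1: "D j powr (a - 1) / 2 \<le> E j powr (a - 1)"
      proof -
        have "D j powr (a - 1) / 2 = 2 powr (- 1) * D j powr (a - 1)" by (simp add: powr_minus)
        also have "\<dots> \<le> 2 powr (a - 1) * D j powr (a - 1)"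
          using a by (intro mult_right_mono powr_mono) auto
        also have "\<dots> = (2 * D j) powr (a - 1)" using Dpos[of j] by (simp add: powr_mult)
        also have "\<dots> \<le> E j powr (a - 1)" using a Eup Epos by (intro powr_mono2') auto
        finally show ?thesis .
      qed
      have 2: "E j powr (a - 1) \<le> 2 * D j powr (a - 1)"
      proof -
        have "E j powr (a - 1) \<le> (D j * (1/2)) powr (a - 1)"
          using a Elo Dpos[of j] by (intro powr_mono2') auto
        also have "\<dots> = D j powr (a - 1) * 2 powr (1 - a)"
          using Dpos[of j] by (simp add: powr_mult powr_divide powr_diff)
        also have "\<dots> \<le> D j powr (a - 1) * 2 powr 1"
          using a by (intro mult_left_mono powr_mono) auto
        finally show ?thesis by simp
      qed
      have "B j * D j powr (a - 1) / 2 - 2 * D j powr a \<le> (B j - A j) * E j powr (a - 1)"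
      proof -
        have "B j * (D j powr (a - 1) / 2) \<le> B j * E j powr (a - 1)"
          using 1 nonneg[OF B] by (rule mult_left_mono)
        moreover have "A j * E j powr (a - 1) \<le> D j * (2 * D j powr (a - 1))"
          using 2 nonneg[OF A(1), of j] \<delta>[of j] by (intro mult_mono) (auto simp: D_def)
        moreover have "D j * D j powr (a - 1) = D j powr a"
          using Dpos[of j] by (simp add: powr_mult_base)
        ultimately show ?thesis by (simp add: algebra_simps)
      qed
      then have "a * \<tau> * (B j * D j powr (a - 1) / 2 - 2 * D j powr a)
          \<le> a * \<tau> * ((B j - A j) * E j powr (a - 1))"
        using a \<tau> by (intro mult_left_mono) auto
      also have "\<dots> = - (a * E j powr (a - 1) * (D j - E j))" by (simp add: ED algebra_simps)
      also have "\<dots> \<le> E j powr a - D j powr a"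
        using powr_le_tangent[of "D j" "E j" a] Dpos[of j] Epos a by simp
      finally show ?thesis .
    qed
    have "a * \<tau> * ((\<Sum>j<m. B j * D j powr (a - 1)) / 2 - 2 * (\<Sum>j<m. D j powr a))
       = (\<Sum>j<m. a * \<tau> * (B j * D j powr (a - 1) / 2 - 2 * D j powr a))"
      unfolding sum_distrib_left[symmetric, where r = "a * \<tau>"] sum_subtractf
      by (simp only: sum_divide_distrib sum_distrib_left)
    also have "\<dots> \<le> (\<Sum>j<m. E j powr a - D j powr a)" using tangent by (intro sum_mono) auto
    also have "\<dots> \<le> a * \<tau> * S0" using FE by (simp add: sum_subtractf \<eta>_def)
    finally have "(\<Sum>j<m. B j * D j powr (a - 1)) / 2 - 2 * (\<Sum>j<m. D j powr a) \<le> S0"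
      using a \<tau> by simp
    moreover have "S0 \<le> (\<Sum>j<m. D j powr a)" using F_ge[OF A(1)] by (simp add: F_def D_def)
    ultimately have "(\<Sum>j<m. B j * D j powr (a - 1)) \<le> 6 * (\<Sum>j<m. D j powr a)" by simp
    then show "(\<Sum>j<m. B j * (A j + \<delta> j) powr (a - 1)) \<le> 6 * (\<Sum>j<m. (A j + \<delta> j) powr a)"
      by (simp add: D_def)
  qed
qed

section \<open>Norms of combinations and the use of cotype 2\<close>
lemma norm_le_if_dual_le:
  assumes "normed_space_over sc" and "\<And>\<phi>. \<phi> \<in> dual_ball sc X \<Longrightarrow> norm (\<phi> v) \<le> K"
  shows "norm v \<le> K"
proof -
  obtain \<phi> where "\<phi> \<in> dual_ball sc X" "norm v \<le> norm (\<phi> v)"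
    using norming_functional[OF assms(1)] by blast
  with assms(2)[of \<phi>] show ?thesis by simp
qed

lemma combination_mem:
  fixes m :: nat
  assumes sc: "normed_space_over sc" and X: "module.subspace sc X"
    and x: "\<And>j. j < m \<Longrightarrow> x j \<in> X"
  shows "(\<Sum>j<m. sc (b j) (x j)) \<in> X"
proof -
  interpret normed_space_over sc by (rule sc)
  show ?thesis by (intro subspace_sum subspace_scale X x) auto
qed

lemma dual_ball_combination:
  fixes m :: nat
  assumes sc: "normed_space_over sc" and X: "module.subspace sc X" and \<phi>: "\<phi> \<in> dual_ball sc X"
    and x: "\<And>j. j < m \<Longrightarrow> x j \<in> X"
  shows "\<phi> (\<Sum>j<m. sc (b j) (x j)) = (\<Sum>j<m. b j * \<phi> (x j))"
  using x
proof (induction m)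
  interpret normed_space_over sc by (rule sc)
  case 0
  have "\<phi> (sc 0 0) = 0 * \<phi> 0" using \<phi> subspace_0[OF X] unfolding dual_ball_def by blast
  then show ?case by simp
next
  interpret normed_space_over sc by (rule sc)
  case (Suc k)
  have "(\<Sum>j<k. sc (b j) (x j)) \<in> X" by (rule combination_mem[OF sc X]) (simp add: Suc.prems)
  then show ?case
    using \<phi> Suc subspace_scale[OF X] by (simp add: dual_ball_def)
qed

text \<open>
  Put \<open>g\<^sub>j = D\<^sub>j powr (p/2 - 1/2)\<close>. The elementary inequality \<open>t \<le> M g + t\<^sup>2 / (M g)\<close> splits each
  \<open>|b\<^sub>j|\<close> into a part of size \<open>M g\<^sub>j\<close> and a part that matters only if \<open>|b\<^sub>j|\<close> is large compared
  with \<open>g\<^sub>j\<close>. Against a functional, the first part is estimated with Hoelder's inequality for the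
  exponent \<open>p\<close>, the second with the Cauchy-Schwarz inequality and the hypothesis \<open>opt\<close>. The parameter
  \<open>M\<close> is free: a large \<open>M\<close> makes the contribution of the second part small.
\<close>
lemma norm_combination_bound:
  fixes sc :: "'k::real_or_complex \<Rightarrow> 'a::real_normed_vector \<Rightarrow> 'a" and b :: "nat \<Rightarrow> 'k"
  assumes sc: "normed_space_over sc" and X: "module.subspace sc X" and x: "\<And>j. j < m \<Longrightarrow> x j \<in> X"
    and p: "1 \<le> p" and V: "0 < V" and M: "0 < M"
    and D: "\<And>j. j < m \<Longrightarrow> 0 < D j" and S: "S = (\<Sum>j<m. D j powr (p/2))"
    and weak: "\<And>\<phi>. \<phi> \<in> dual_ball sc X \<Longrightarrow> (\<Sum>j<m. norm (\<phi> (x j)) powr p) \<le> V"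
    and opt: "\<And>\<phi>. \<phi> \<in> dual_ball sc X \<Longrightarrow>
      (\<Sum>j<m. (norm (\<phi> (x j)))\<^sup>2 * D j powr (p/2 - 1)) \<le> 6 * S"
  shows "(norm (\<Sum>j<m. sc (b j) (x j)))\<^sup>2
    \<le> 8 * M\<^sup>2 * (S powr (1 - 1/p) * V powr (1/p))\<^sup>2
      + 12 * S / M\<^sup>2 * (\<Sum>j<m. norm (b j) ^ 4 * D j powr (2 - 3*p/2))"
proof (cases "m = 0")
  case True then show ?thesis by (simp add: S)
next
  case False
  have Spos: "S > 0" unfolding S using False D
    by (intro sum_pos) (auto dest: less_imp_neq[symmetric])
  define H where "H = S powr (1 - 1/p) * V powr (1/p)"
  have H0: "H > 0" using Spos V by (simp add: H_def)
  define Q where "Q = (\<Sum>j<m. norm (b j) ^ 4 * D j powr (2 - 3*p/2))"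
  define g where "g j = D j powr (p/2 - 1/2)" for j
  have g: "g j > 0" if "j < m" for j using D[OF that] by (simp add: g_def)
  have Q0: "Q \<ge> 0" unfolding Q_def by (intro sum_nonneg) auto
  have "norm (\<Sum>j<m. sc (b j) (x j)) \<le> 2 * M * H + sqrt (6 * S * Q) / M"
  proof (rule norm_le_if_dual_le[OF sc])
    fix \<phi> assume \<phi>: "\<phi> \<in> dual_ball sc X"
    let ?y = "\<lambda>j. norm (\<phi> (x j))"
    \<comment> \<open>Young's inequality for terms normalized by \<open>S\<close> and \<open>V\<close> keeps the estimate homogeneous.\<close>
    have 1: "(\<Sum>j<m. g j * ?y j) \<le> 2 * H"
    proof -
      have "g j * ?y j / H \<le> D j powr (p/2) / S + ?y j powr p / V" if "j < m" for j
      proof -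
        have "g j * ?y j / H = (D j powr (p/2) / S) powr (1 - 1/p) * (?y j powr p / V) powr (1 - (1 - 1/p))"
        proof -
          have "p/2 * (1 - 1/p) = p/2 - 1/2" using p by (simp add: field_simps)
          then have "(D j powr (p/2)) powr (1 - 1/p) = g j" by (simp only: g_def powr_powr)
          moreover have "(?y j powr p) powr (1/p) = ?y j" using p by (simp add: powr_powr)
          ultimately show ?thesis using Spos V by (simp add: H_def powr_divide)
        qed
        also have "\<dots> \<le> D j powr (p/2) / S + ?y j powr p / V"
          using p Spos V by (intro powr_product_le_sum) auto
        finally show ?thesis .
      qed
      then have "(\<Sum>j<m. g j * ?y j / H) \<le> (\<Sum>j<m. D j powr (p/2) / S + ?y j powr p / V)"
        by (intro sum_mono) auto
      also have "\<dots> = 1 + (\<Sum>j<m. ?y j powr p) / V"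
        using Spos by (simp add: sum.distrib S flip: sum_divide_distrib)
      also have "\<dots> \<le> 2" using weak[OF \<phi>] V by simp
      finally have "(\<Sum>j<m. g j * ?y j) / H \<le> 2" by (simp add: sum_divide_distrib)
      then show ?thesis using H0 by (simp add: field_simps)
    qed
    have 2: "(\<Sum>j<m. (norm (b j))\<^sup>2 / g j * ?y j) \<le> sqrt (6 * S * Q)"
    proof (rule real_le_rsqrt)
      have "(norm (b j))\<^sup>2 / g j * ?y j
          = ((norm (b j))\<^sup>2 * D j powr (1 - 3*p/4)) * (?y j * D j powr (p/4 - 1/2))" if "j < m" for j
      proof -
        have "1 / g j = D j powr (- (p/2 - 1/2))" unfolding g_def powr_minus by (simp add: field_simps)
        also have "- (p/2 - 1/2) = (1 - 3*p/4) + (p/4 - 1/2)" by simp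
        also have "D j powr \<dots> = D j powr (1 - 3*p/4) * D j powr (p/4 - 1/2)" by (rule powr_add)
        finally have "1 / g j = D j powr (1 - 3*p/4) * D j powr (p/4 - 1/2)" .
        moreover have "(norm (b j))\<^sup>2 / g j * ?y j = (norm (b j))\<^sup>2 * ?y j * (1 / g j)" by simp
        ultimately show ?thesis by (simp only: mult_ac)
      qed
      then have "(\<Sum>j<m. (norm (b j))\<^sup>2 / g j * ?y j)\<^sup>2
          = (\<Sum>j<m. ((norm (b j))\<^sup>2 * D j powr (1 - 3*p/4)) * (?y j * D j powr (p/4 - 1/2)))\<^sup>2"
        by (intro arg_cong[where f="\<lambda>z. z\<^sup>2"] sum.cong) auto
      also have "\<dots> \<le> (\<Sum>j<m. ((norm (b j))\<^sup>2 * D j powr (1 - 3*p/4))\<^sup>2)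
           * (\<Sum>j<m. (?y j * D j powr (p/4 - 1/2))\<^sup>2)"
        by (rule Cauchy_Schwarz_ineq_sum)
      also have "(\<Sum>j<m. ((norm (b j))\<^sup>2 * D j powr (1 - 3*p/4))\<^sup>2) = Q"
        unfolding Q_def
      proof (intro sum.cong refl)
        fix j assume "j \<in> {..<m}"
        then have "(D j powr (1 - 3*p/4))\<^sup>2 = D j powr (2 - 3*p/2)"
          using D[of j] by (simp add: power2_eq_square algebra_simps flip: powr_add)
        then show "((norm (b j))\<^sup>2 * D j powr (1 - 3*p/4))\<^sup>2 = norm (b j) ^ 4 * D j powr (2 - 3*p/2)"
          by (simp add: power_mult_distrib)
      qed
      also have "(\<Sum>j<m. (?y j * D j powr (p/4 - 1/2))\<^sup>2) = (\<Sum>j<m. (?y j)\<^sup>2 * D j powr (p/2 - 1))"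
      proof (intro sum.cong refl)
        fix j assume "j \<in> {..<m}"
        then have "(D j powr (p/4 - 1/2))\<^sup>2 = D j powr (p/2 - 1)"
          using D[of j] by (simp add: power2_eq_square algebra_simps flip: powr_add)
        then show "(?y j * D j powr (p/4 - 1/2))\<^sup>2 = (?y j)\<^sup>2 * D j powr (p/2 - 1)"
          by (simp add: power_mult_distrib)
      qed
      also have "Q * \<dots> \<le> Q * (6 * S)" using opt[OF \<phi>] Q0 by (rule mult_left_mono)
      finally show "(\<Sum>j<m. (norm (b j))\<^sup>2 / g j * ?y j)\<^sup>2 \<le> 6 * S * Q" by (simp add: mult_ac)
    qed
    have b_le: "norm (b j) \<le> M * g j + (norm (b j))\<^sup>2 / g j / M" if "j < m" for j
    proof -
      let ?t = "M * g j" and ?n = "norm (b j)"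
      have t: "?t > 0" using g[OF that] M by simp
      have "0 \<le> ?n * ?t" using t by simp
      then have "?n * ?t \<le> ?t\<^sup>2 + ?n\<^sup>2"
        using sum_squares_bound[of ?n ?t] by linarith
      then have "?n \<le> (?t\<^sup>2 + ?n\<^sup>2) / ?t" using t by (simp add: field_simps)
      also have "\<dots> = ?t + ?n\<^sup>2 / g j / M" using t g[OF that] M
        by (simp add: field_simps power2_eq_square)
      finally show ?thesis .
    qed
    have "\<phi> (\<Sum>j<m. sc (b j) (x j)) = (\<Sum>j<m. b j * \<phi> (x j))"
      by (rule dual_ball_combination[OF sc X \<phi> x])
    then have "norm (\<phi> (\<Sum>j<m. sc (b j) (x j))) \<le> (\<Sum>j<m. norm (b j) * ?y j)"
      using norm_sum[of "\<lambda>j. b j * \<phi> (x j)" "{..<m}"] by (simp add: norm_mult)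
    also have "\<dots> \<le> (\<Sum>j<m. (M * g j + (norm (b j))\<^sup>2 / g j / M) * ?y j)"
      using b_le by (intro sum_mono mult_right_mono) auto
    also have "\<dots> = M * (\<Sum>j<m. g j * ?y j) + (\<Sum>j<m. (norm (b j))\<^sup>2 / g j * ?y j) / M"
      unfolding sum_distrib_left sum_divide_distrib sum.distrib[symmetric]
      by (intro sum.cong refl) (simp add: algebra_simps)
    also have "\<dots> \<le> M * (2 * H) + sqrt (6 * S * Q) / M"
      using 1 2 M by (intro add_mono mult_left_mono divide_right_mono) auto
    finally show "norm (\<phi> (\<Sum>j<m. sc (b j) (x j))) \<le> 2 * M * H + sqrt (6 * S * Q) / M" by simp
  qed
  then have "(norm (\<Sum>j<m. sc (b j) (x j)))\<^sup>2 \<le> (2 * M * H + sqrt (6 * S * Q) / M)\<^sup>2"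
    by (rule power_mono) simp
  also have "\<dots> \<le> 2 * (2 * M * H)\<^sup>2 + 2 * (sqrt (6 * S * Q) / M)\<^sup>2"
    using sum_squares_bound[of "2 * M * H" "sqrt (6 * S * Q) / M"] by (simp add: power2_sum)
  also have "\<dots> = 8 * M\<^sup>2 * H\<^sup>2 + 12 * S / M\<^sup>2 * Q"
    using Spos Q0 by (simp add: power_mult_distrib power_divide)
  finally show ?thesis by (simp add: H_def Q_def)
qed

text \<open>
  The left-hand side is the square of \<open>\<Sum>\<^sub>i sqrt w\<^sub>i * \<phi>\<^sub>i z\<^sub>i\<close>, where \<open>z\<^sub>i\<close> is the combination of the
  \<open>x\<^sub>j\<close> with coefficients \<open>f i j\<close>. So it is at most \<open>\<Sum> \<parallel>z\<^sub>i\<parallel>\<^sup>2\<close>, and by cotype 2 at most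
  \<open>C\<^sup>2\<close> times the mean of \<open>\<parallel>\<Sum>\<^sub>i \<epsilon>\<^sub>i z\<^sub>i\<parallel>\<^sup>2\<close>. For each choice of signs the vector
  \<open>\<Sum>\<^sub>i \<epsilon>\<^sub>i z\<^sub>i\<close> is the combination of the \<open>x\<^sub>j\<close> whose coefficients are the Rademacher sums of the
  \<open>f i j\<close>; its norm is estimated by \<open>norm_combination_bound\<close>, and the fourth moments
  that appear there are bounded by the Khintchine inequality.
\<close>
lemma square_mean_bound:
  fixes sc :: "'k::real_or_complex \<Rightarrow> 'a::real_normed_vector \<Rightarrow> 'a" and \<phi> :: "nat \<Rightarrow> 'a \<Rightarrow> 'k" and m :: nat
  assumes sc: "normed_space_over sc" and X: "module.subspace sc X" and x: "\<And>j. j < m \<Longrightarrow> x j \<in> X"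
    and cot: "\<And>N z. (\<And>i. i < N \<Longrightarrow> z i \<in> X) \<Longrightarrow>
      (\<Sum>i<N. (norm (z i))\<^sup>2) \<le> C\<^sup>2 * rademacher_mean_square N z"
    and p: "1 \<le> p" and V: "0 < V" and M: "0 < M"
    and D: "\<And>j. j < m \<Longrightarrow> 0 < D j" and S: "S = (\<Sum>j<m. D j powr (p/2))"
    and weak: "\<And>\<phi>. \<phi> \<in> dual_ball sc X \<Longrightarrow> (\<Sum>j<m. norm (\<phi> (x j)) powr p) \<le> V"
    and opt: "\<And>\<phi>. \<phi> \<in> dual_ball sc X \<Longrightarrow>
      (\<Sum>j<m. (norm (\<phi> (x j)))\<^sup>2 * D j powr (p/2 - 1)) \<le> 6 * S"
    and w: "\<And>i. i < N \<Longrightarrow> 0 \<le> w i" "(\<Sum>i<N. w i) = 1"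
    and \<phi>: "\<And>i. i < N \<Longrightarrow> \<phi> i \<in> dual_ball sc X"
    and A: "\<And>j. A j = (\<Sum>i<N. w i * (norm (\<phi> i (x j)))\<^sup>2)" and AD: "\<And>j. j < m \<Longrightarrow> A j \<le> D j"
  shows "(\<Sum>j<m. A j * D j powr (p/2 - 1))\<^sup>2
    \<le> C\<^sup>2 * (8 * M\<^sup>2 * (S powr (1 - 1/p) * V powr (1/p))\<^sup>2 + 36 * S\<^sup>2 / M\<^sup>2)"
proof -
  define a where "a = p/2 - 1"
  define H where "H = S powr (1 - 1/p) * V powr (1/p)"
  \<comment> \<open>Up to positive factors \<open>f i j\<close> is the complex conjugate of \<open>\<phi> i (x j)\<close>, written as
    \<open>|c|\<^sup>2 / c\<close>; for \<open>c = 0\<close> division by zero gives the right value 0.\<close>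
  define f where "f i j = (of_real (sqrt (w i) * D j powr a * (norm (\<phi> i (x j)))\<^sup>2) / \<phi> i (x j) :: 'k)" for i j
  define z where "z i = (\<Sum>j<m. sc (f i j) (x j))" for i
  have S0: "S \<ge> 0" unfolding S by (intro sum_nonneg) auto
  have zX: "z i \<in> X" if "i < N" for i
    unfolding z_def by (rule combination_mem[OF sc X]) (rule x)
  have z_ge: "sqrt (w i) * (\<Sum>j<m. (norm (\<phi> i (x j)))\<^sup>2 * D j powr a) \<le> norm (z i)" if i: "i < N" for i
  proof -
    have "\<phi> i (z i) = (\<Sum>j<m. f i j * \<phi> i (x j))"
      unfolding z_def by (rule dual_ball_combination[OF sc X \<phi>[OF i] x])
    also have "\<dots> = (\<Sum>j<m. of_real (sqrt (w i) * D j powr a * (norm (\<phi> i (x j)))\<^sup>2))"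
      by (intro sum.cong refl) (auto simp: f_def)
    also have "\<dots> = of_real (sqrt (w i) * (\<Sum>j<m. (norm (\<phi> i (x j)))\<^sup>2 * D j powr a))"
      by (simp add: sum_distrib_left mult_ac)
    finally have "norm (\<phi> i (z i)) = \<bar>sqrt (w i) * (\<Sum>j<m. (norm (\<phi> i (x j)))\<^sup>2 * D j powr a)\<bar>"
      by (simp only: norm_of_real)
    moreover have "norm (\<phi> i (z i)) \<le> norm (z i)"
      using \<phi>[OF i] zX[OF i] by (simp add: dual_ball_def)
    ultimately show ?thesis by linarith
  qed
  have "(\<Sum>j<m. A j * D j powr a) = (\<Sum>i<N. w i * (\<Sum>j<m. (norm (\<phi> i (x j)))\<^sup>2 * D j powr a))"
    unfolding A sum_distrib_left sum_distrib_right by (subst sum.swap) (simp add: mult_ac)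
  also have "\<dots> = (\<Sum>i<N. sqrt (w i) * (sqrt (w i) * (\<Sum>j<m. (norm (\<phi> i (x j)))\<^sup>2 * D j powr a)))"
    using w(1) by (intro sum.cong refl) (simp flip: mult.assoc)
  also have "\<dots> \<le> (\<Sum>i<N. sqrt (w i) * norm (z i))"
    using z_ge w(1) by (intro sum_mono mult_left_mono) auto
  finally have T: "(\<Sum>j<m. A j * D j powr a) \<le> (\<Sum>i<N. sqrt (w i) * norm (z i))" .
  have "0 \<le> (\<Sum>j<m. A j * D j powr a)"
    unfolding A using w(1) by (intro sum_nonneg mult_nonneg_nonneg) auto
  with T have "(\<Sum>j<m. A j * D j powr a)\<^sup>2 \<le> (\<Sum>i<N. sqrt (w i) * norm (z i))\<^sup>2"
    by (rule power_mono)
  also have "\<dots> \<le> (\<Sum>i<N. (sqrt (w i))\<^sup>2) * (\<Sum>i<N. (norm (z i))\<^sup>2)"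
    by (rule Cauchy_Schwarz_ineq_sum)
  also have "(\<Sum>i<N. (sqrt (w i))\<^sup>2) = 1" using w by simp
  also have "1 * (\<Sum>i<N. (norm (z i))\<^sup>2) \<le> C\<^sup>2 * rademacher_mean_square N z"
    using cot zX by simp
  also have "\<dots> \<le> C\<^sup>2 * (8 * M\<^sup>2 * H\<^sup>2 + 36 * S\<^sup>2 / M\<^sup>2)"
  proof (rule mult_left_mono)
    define G where "G \<epsilon> j = (\<Sum>i<N. \<epsilon> i *\<^sub>R f i j)" for \<epsilon> :: "nat \<Rightarrow> real" and j
    interpret normed_space_over sc by (rule sc)
    have "(\<Sum>i<N. \<epsilon> i *\<^sub>R z i) = (\<Sum>j<m. sc (G \<epsilon> j) (x j))" for \<epsilon>
    proof -
      have "(\<Sum>i<N. \<epsilon> i *\<^sub>R z i) = (\<Sum>i<N. \<Sum>j<m. sc (\<epsilon> i *\<^sub>R f i j) (x j))"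
        by (simp add: z_def scale_sum_right scaleR_conv_of_real flip: sc_of_real)
      also have "\<dots> = (\<Sum>j<m. sc (G \<epsilon> j) (x j))"
        unfolding G_def scale_sum_left by (rule sum.swap)
      finally show ?thesis .
    qed
    then have "(\<Sum>\<epsilon>\<in>signs N. (norm (\<Sum>i<N. \<epsilon> i *\<^sub>R z i))\<^sup>2)
       \<le> (\<Sum>\<epsilon>\<in>signs N. 8 * M\<^sup>2 * H\<^sup>2
            + 12 * S / M\<^sup>2 * (\<Sum>j<m. norm (G \<epsilon> j) ^ 4 * D j powr (2 - 3*p/2)))"
      using norm_combination_bound[where x = x and D = D and m = m, OF sc X x p V M D S weak opt] unfolding H_def
      by (intro sum_mono) simp
    also have "\<dots> = 2 ^ N * (8 * M\<^sup>2 * H\<^sup>2)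
       + 12 * S / M\<^sup>2 * (\<Sum>j<m. (\<Sum>\<epsilon>\<in>signs N. norm (G \<epsilon> j) ^ 4) * D j powr (2 - 3*p/2))"
    proof -
      have swap: "(\<Sum>\<epsilon>\<in>signs N. \<Sum>j<m. norm (G \<epsilon> j) ^ 4 * D j powr (2 - 3*p/2))
          = (\<Sum>j<m. (\<Sum>\<epsilon>\<in>signs N. norm (G \<epsilon> j) ^ 4) * D j powr (2 - 3*p/2))"
        unfolding sum_distrib_right by (rule sum.swap)
      show ?thesis
        unfolding sum.distrib sum_distrib_left[symmetric, where r = "12 * S / M\<^sup>2"] swap
        by (simp add: card_signs)
    qed
    also have "\<dots> \<le> 2 ^ N * (8 * M\<^sup>2 * H\<^sup>2) + 12 * S / M\<^sup>2 * (\<Sum>j<m. 2 ^ N * (3 * D j powr (p/2)))"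
    proof (intro add_left_mono mult_left_mono sum_mono)
      fix j assume "j \<in> {..<m}"
      then have j: "j < m" by simp
      let ?s = "\<Sum>i<N. (norm (f i j))\<^sup>2"
      have "(norm (f i j))\<^sup>2 = w i * (norm (\<phi> i (x j)))\<^sup>2 * D j powr (2 * a)" if "i < N" for i
      proof -
        have "(D j powr a)\<^sup>2 = D j powr (2 * a)"
          using D[OF j] by (simp add: power2_eq_square flip: powr_add)
        moreover have "(norm (f i j))\<^sup>2 = (sqrt (w i) * norm (\<phi> i (x j)) * D j powr a)\<^sup>2"
          by (simp add: f_def norm_divide norm_mult power2_eq_square abs_mult)
        ultimately show ?thesis using w(1)[OF that] by (simp add: power_mult_distrib)
      qed
      then have "?s = A j * D j powr (2 * a)" by (simp add: A sum_distrib_right)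
      also have "\<dots> \<le> D j * D j powr (2 * a)" using AD[OF j] by (rule mult_right_mono) simp
      also have "\<dots> = D j powr (p - 1)" using D[OF j] by (simp add: powr_mult_base a_def)
      finally have s: "?s \<le> D j powr (p - 1)" .
      have "(\<Sum>\<epsilon>\<in>signs N. norm (G \<epsilon> j) ^ 4) * D j powr (2 - 3*p/2)
          \<le> 2 ^ N * (3 * ?s\<^sup>2) * D j powr (2 - 3*p/2)"
        unfolding G_def by (intro mult_right_mono sum_signs_fourth) auto
      also have "\<dots> \<le> 2 ^ N * (3 * (D j powr (p - 1))\<^sup>2) * D j powr (2 - 3*p/2)"
        using s by (intro mult_right_mono mult_left_mono power_mono) (auto intro: sum_nonneg)
      also have "\<dots> = 2 ^ N * (3 * D j powr (p/2))"
      proof -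
        have "(D j powr (p - 1))\<^sup>2 * D j powr (2 - 3*p/2) = D j powr ((p - 1) + (p - 1) + (2 - 3*p/2))"
          unfolding powr_add power2_eq_square ..
        also have "(p - 1) + (p - 1) + (2 - 3*p/2) = p/2" by (simp add: field_simps)
        finally show ?thesis by (simp add: mult_ac)
      qed
      finally show "(\<Sum>\<epsilon>\<in>signs N. norm (G \<epsilon> j) ^ 4) * D j powr (2 - 3*p/2) \<le> 2 ^ N * (3 * D j powr (p/2))" .
    qed (use S0 in auto)
    also have "\<dots> = 2 ^ N * (8 * M\<^sup>2 * H\<^sup>2 + 36 * S\<^sup>2 / M\<^sup>2)"
      by (simp add: S power2_eq_square algebra_simps flip: sum_distrib_left)
    finally show "rademacher_mean_square N z \<le> 8 * M\<^sup>2 * H\<^sup>2 + 36 * S\<^sup>2 / M\<^sup>2"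
      unfolding rademacher_mean_square_def by (simp add: field_simps)
  qed simp
  finally show ?thesis by (simp add: a_def H_def)
qed

section \<open>The weights attached to a weakly summable sequence\<close>

text \<open>The convex hull of the sequences \<open>(|\<phi>(x\<^sub>j)|\<^sup>2)\<^sub>j\<close>, with \<open>\<phi>\<close> in the dual ball.\<close>
definition weighted_moments :: "('k::real_or_complex \<Rightarrow> 'a::real_normed_vector \<Rightarrow> 'a) \<Rightarrow> 'a set \<Rightarrow> (nat \<Rightarrow> 'a) \<Rightarrow> (nat \<Rightarrow> real) set" where
  "weighted_moments sc X x = {A. \<exists>N w \<phi>. (\<forall>i<N. 0 \<le> w i) \<and> (\<Sum>i<N. w i) = 1 \<and>
     (\<forall>i<N. \<phi> i \<in> dual_ball sc X) \<and> A = (\<lambda>j. \<Sum>i<N::nat. w i * (norm (\<phi> i (x j)))\<^sup>2)}"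

lemma weighted_moments_single:
  assumes "\<phi> \<in> dual_ball sc X"
  shows "(\<lambda>j. (norm (\<phi> (x j)))\<^sup>2) \<in> weighted_moments sc X x"
  unfolding weighted_moments_def mem_Collect_eq
  by (rule exI[of _ 1], rule exI[of _ "\<lambda>_. 1"], rule exI[of _ "\<lambda>_. \<phi>"]) (use assms in auto)

lemma weighted_moments_convex:
  assumes "A \<in> weighted_moments sc X x" "B \<in> weighted_moments sc X x" "0 \<le> \<tau>" "\<tau> \<le> 1"
  shows "(\<lambda>j. (1 - \<tau>) * A j + \<tau> * B j) \<in> weighted_moments sc X x"
proof -
  obtain N w \<phi> where 1: "\<forall>i<N. 0 \<le> w i" "(\<Sum>i<N. w i) = 1"
    "\<forall>i<N. \<phi> i \<in> dual_ball sc X" "A = (\<lambda>j. \<Sum>i<N::nat. w i * (norm (\<phi> i (x j)))\<^sup>2)"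
    using assms(1) unfolding weighted_moments_def by blast
  obtain N' w' \<phi>' where 2: "\<forall>i<N'. 0 \<le> w' i" "(\<Sum>i<N'. w' i) = 1"
    "\<forall>i<N'. \<phi>' i \<in> dual_ball sc X" "B = (\<lambda>j. \<Sum>i<N'::nat. w' i * (norm (\<phi>' i (x j)))\<^sup>2)"
    using assms(2) unfolding weighted_moments_def by blast
  define v where "v i = (if i < N then (1 - \<tau>) * w i else \<tau> * w' (i - N))" for i
  define \<psi> where "\<psi> i = (if i < N then \<phi> i else \<phi>' (i - N))" for i
  have split: "(\<Sum>i<N + N'. h i) = (\<Sum>i<N. h i) + (\<Sum>i<N'. h (N + i))" for h :: "nat \<Rightarrow> real"
    by (induction N') auto
  show ?thesis
    unfolding weighted_moments_def mem_Collect_eq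
  proof (intro exI conjI)
    show "\<forall>i<N + N'. 0 \<le> v i" using 1 2 assms(3,4) by (auto simp: v_def)
    show "(\<Sum>i<N + N'. v i) = 1"
      using 1 2 by (simp add: split v_def flip: sum_distrib_left)
    show "\<forall>i<N + N'. \<psi> i \<in> dual_ball sc X" using 1 2 by (auto simp: \<psi>_def)
    show "(\<lambda>j. (1 - \<tau>) * A j + \<tau> * B j) = (\<lambda>j. \<Sum>i<N + N'. v i * (norm (\<psi> i (x j)))\<^sup>2)"
      by (simp add: split v_def \<psi>_def 1(4) 2(4) sum_distrib_left mult.assoc)
  qed
qed

text \<open>
  The weights are \<open>d\<^sub>j = D\<^sub>j powr (p/2)\<close> with \<open>D = A + \<delta>\<close>, where \<open>A\<close> is a near maximizer for the first
  \<open>m\<close> terms. Choosing \<open>M\<close> large enough in \<open>square_mean_bound\<close> absorbs the quadratic term in \<open>S\<close>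
  and bounds \<open>S = \<Sum> d\<^sub>j\<close> independently of \<open>m\<close>. The shifts satisfy \<open>\<Sum> \<delta>\<^sub>j powr (p/2) \<le> 1\<close>, so that they
  do not spoil this bound. They do not depend on \<open>m\<close> either, so they also provide the lower bound
  that keeps \<open>d\<close> positive when \<open>m\<close> tends to infinity.
\<close>
lemma weights_for_finite_sections:
  fixes sc :: "'k::real_or_complex \<Rightarrow> 'a::real_normed_vector \<Rightarrow> 'a"
  assumes sc: "normed_space_over sc" and X: "module.subspace sc X" and x: "\<And>j. x j \<in> X"
    and cotype: "has_cotype 2 X" and p: "1 \<le> p" "p \<le> 2"
    and weak: "\<And>\<phi> m. \<phi> \<in> dual_ball sc X \<Longrightarrow> (\<Sum>j<m. norm (\<phi> (x j)) powr p) \<le> V"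
  shows "\<exists>K. \<forall>m. \<exists>d. (\<forall>j. (1/2) ^ Suc j \<le> d j) \<and> (\<Sum>j<m. d j) \<le> K \<and>
      (\<forall>\<phi>\<in>dual_ball sc X. (\<Sum>j<m. (norm (\<phi> (x j)))\<^sup>2 * d j powr (1 - 2/p)) \<le> K)"
proof -
  obtain C where C: "C \<ge> 0" "\<And>m z. (\<forall>j<m. z j \<in> X) \<Longrightarrow>
      (\<Sum>j<m. norm (z j) powr 2) powr (1/2) \<le> C * sqrt (rademacher_mean_square m z)"
    using cotype unfolding has_cotype_def by blast
  have cot: "(\<Sum>i<N. (norm (z i))\<^sup>2) \<le> C\<^sup>2 * rademacher_mean_square N z"
    if "\<And>i. i < N \<Longrightarrow> z i \<in> X" for N z
  proof -
    have r: "0 \<le> rademacher_mean_square N z"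
      unfolding rademacher_mean_square_def by (intro divide_nonneg_nonneg sum_nonneg) auto
    have "sqrt (\<Sum>i<N. (norm (z i))\<^sup>2) \<le> C * sqrt (rademacher_mean_square N z)"
      using C(2)[of N z] that by (simp add: powr_half_sqrt sum_nonneg)
    then have "(sqrt (\<Sum>i<N. (norm (z i))\<^sup>2))\<^sup>2 \<le> (C * sqrt (rademacher_mean_square N z))\<^sup>2"
      by (rule power_mono) (simp add: sum_nonneg)
    then show ?thesis using r by (simp add: power_mult_distrib sum_nonneg)
  qed
  define W where "W = max V 1"
  have W: "W > 0" and weakW: "\<And>\<phi> m. \<phi> \<in> dual_ball sc X \<Longrightarrow> (\<Sum>j<m. norm (\<phi> (x j)) powr p) \<le> W"
    using weak by (auto simp: W_def intro: max.coboundedI1)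
  define a where "a = p/2"
  have a: "0 < a" "a \<le> 1" using p by (auto simp: a_def)
  \<comment> \<open>288 = 36 * 8, so that the term \<open>36 * C\<^sup>2 * S\<^sup>2 / M\<^sup>2\<close> becomes at most \<open>S\<^sup>2 / 8\<close>, half of the
    lower bound \<open>S\<^sup>2 / 4\<close> that holds for \<open>S > 2\<close>.\<close>
  define M where "M = sqrt (288 * (C\<^sup>2 + 1))"
  have M: "M > 0" "M\<^sup>2 = 288 * (C\<^sup>2 + 1)"
    unfolding M_def by (simp_all add: add_nonneg_pos)
  define L where "L = 64 * C\<^sup>2 * M\<^sup>2 * (W powr (1/p))\<^sup>2"
  define \<delta> :: "nat \<Rightarrow> real" where "\<delta> j = ((1/2) ^ Suc j) powr (1/a)" for j
  have \<delta>: "\<delta> j > 0" "\<delta> j powr a = (1/2) ^ Suc j" for j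
    using a by (simp_all add: \<delta>_def powr_powr)
  have \<delta>_sum: "(\<Sum>j<m. \<delta> j powr a) \<le> 1" for m
  proof -
    have "(\<Sum>j<m. (1/2) ^ Suc j) = 1 - (1/2 :: real) ^ m" by (induction m) auto
    then show ?thesis by (simp add: \<delta>(2))
  qed
  show ?thesis
  proof (intro exI[of _ "6 * (2 + L powr a)"] allI)
    fix m
    obtain A where A: "A \<in> weighted_moments sc X x"
      and opt: "\<And>B. B \<in> weighted_moments sc X x \<Longrightarrow>
        (\<Sum>j<m. B j * (A j + \<delta> j) powr (a - 1)) \<le> 6 * (\<Sum>j<m. (A j + \<delta> j) powr a)"
    proof (rule near_maximizer_of_powr_sum[OF a, of "weighted_moments sc X x" "\<lambda>j. (norm (x j))\<^sup>2" \<delta> m])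
      have "(\<lambda>_. 0) \<in> dual_ball sc X" by (simp add: dual_ball_def)
      then show "weighted_moments sc X x \<noteq> {}" using weighted_moments_single by blast
    next
      fix A j assume "A \<in> weighted_moments sc X x"
      then obtain N w \<phi> where N: "\<forall>i<N. 0 \<le> w i" "(\<Sum>i<N. w i) = 1"
        "\<forall>i<N. \<phi> i \<in> dual_ball sc X" "A = (\<lambda>j. \<Sum>i<N::nat. w i * (norm (\<phi> i (x j)))\<^sup>2)"
        unfolding weighted_moments_def by blast
      show "0 \<le> A j" using N by (auto intro: sum_nonneg)
      have "A j \<le> (\<Sum>i<N. w i * (norm (x j))\<^sup>2)"
        unfolding N(4) using N x by (intro sum_mono mult_left_mono power_mono) (auto simp: dual_ball_def)
      then show "A j \<le> (norm (x j))\<^sup>2" using N(2) by (simp flip: sum_distrib_right)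
    qed (use weighted_moments_convex \<delta> in auto)
    define D where "D j = A j + \<delta> j" for j
    define S where "S = (\<Sum>j<m. D j powr a)"
    obtain N w \<phi> where N: "\<And>i. i < N \<Longrightarrow> 0 \<le> w i" "(\<Sum>i<N. w i) = 1"
      "\<And>i. i < N \<Longrightarrow> \<phi> i \<in> dual_ball sc X" "\<And>j. A j = (\<Sum>i<N::nat. w i * (norm (\<phi> i (x j)))\<^sup>2)"
      using A unfolding weighted_moments_def by auto
    have A0: "A j \<ge> 0" for j using N by (auto intro: sum_nonneg)
    have D0: "D j > 0" and \<delta>D: "\<delta> j \<le> D j" for j using A0[of j] \<delta>(1)[of j] by (auto simp: D_def)
    have optD: "(\<Sum>j<m. (norm (\<phi> (x j)))\<^sup>2 * D j powr (a - 1)) \<le> 6 * S" if "\<phi> \<in> dual_ball sc X" for \<phi>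
      using opt[OF weighted_moments_single[OF that]] by (simp add: D_def S_def)
    have main: "(\<Sum>j<m. A j * D j powr (a - 1))\<^sup>2
      \<le> C\<^sup>2 * (8 * M\<^sup>2 * (S powr (1 - 1/p) * W powr (1/p))\<^sup>2 + 36 * S\<^sup>2 / M\<^sup>2)"
      unfolding a_def
    proof (rule square_mean_bound[where sc = sc and X = X and x = x and N = N and w = w and \<phi> = \<phi>])
      show "(\<Sum>j<m. (norm (\<phi> (x j)))\<^sup>2 * D j powr (p/2 - 1)) \<le> 6 * S" if "\<phi> \<in> dual_ball sc X" for \<phi>
        using optD[OF that] by (simp add: a_def)
      show "A j \<le> D j" for j using \<delta>(1)[of j] by (simp add: D_def)
      show "S = (\<Sum>j<m. D j powr (p/2))" by (simp add: S_def a_def)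
    qed (use sc X x cot p W M D0 weakW N in blast)+
    have low: "S - 1 \<le> (\<Sum>j<m. A j * D j powr (a - 1))"
    proof -
      have "D j powr a - \<delta> j powr a \<le> A j * D j powr (a - 1)" for j
      proof -
        have "\<delta> j * D j powr (a - 1) \<le> \<delta> j * \<delta> j powr (a - 1)"
          using \<delta>(1)[of j] \<delta>D[of j] a by (intro mult_left_mono powr_mono2') auto
        also have "\<dots> = \<delta> j powr a" using \<delta>(1)[of j] by (simp add: powr_mult_base)
        finally have "D j * D j powr (a - 1) - \<delta> j powr a \<le> A j * D j powr (a - 1)"
          by (simp add: D_def algebra_simps)
        then show ?thesis using D0[of j] by (simp add: powr_mult_base)
      qed
      then have "(\<Sum>j<m. D j powr a - \<delta> j powr a) \<le> (\<Sum>j<m. A j * D j powr (a - 1))"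
        by (intro sum_mono)
      then show ?thesis using \<delta>_sum[of m] by (simp add: S_def sum_subtractf)
    qed
    have S_le: "S \<le> 2 + L powr a"
    proof (cases "S \<le> 2")
      case True then show ?thesis using powr_ge_zero[of L a] by linarith
    next
      case False
      then have S: "S > 2" by simp
      have "(S/2)\<^sup>2 \<le> (\<Sum>j<m. A j * D j powr (a - 1))\<^sup>2" using low S by (intro power_mono) auto
      also note main
      also have "C\<^sup>2 * (8 * M\<^sup>2 * (S powr (1 - 1/p) * W powr (1/p))\<^sup>2 + 36 * S\<^sup>2 / M\<^sup>2)
         \<le> L / 8 * (S powr (1 - 1/p))\<^sup>2 + S\<^sup>2 / 8"
      proof -
        have "C\<^sup>2 * (36 * S\<^sup>2 / M\<^sup>2) = (C\<^sup>2 / (C\<^sup>2 + 1)) * (S\<^sup>2 / 8)"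
        proof -
          have "c * (36 * r / (288 * k)) = (c / k) * (r / 8)" if "k > 0" for c k r :: real
            using that by (simp add: field_simps)
          then show ?thesis unfolding M(2) by this (simp add: add_nonneg_pos)
        qed
        also have "\<dots> \<le> 1 * (S\<^sup>2 / 8)" by (intro mult_right_mono) (auto simp: divide_le_eq_1 add_nonneg_pos)
        finally show ?thesis by (simp add: L_def power_mult_distrib algebra_simps)
      qed
      finally have "S\<^sup>2 \<le> L * (S powr (1 - 1/p))\<^sup>2" by (simp add: power2_eq_square)
      moreover have "S\<^sup>2 = S powr (1/a) * (S powr (1 - 1/p))\<^sup>2"
      proof -
        have "S powr (1/a) * (S powr (1 - 1/p))\<^sup>2 = S powr (1/a + ((1 - 1/p) + (1 - 1/p)))"
          by (simp only: powr_add power2_eq_square)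
        also have "1/a + ((1 - 1/p) + (1 - 1/p)) = 2" using p by (simp add: a_def field_simps)
        finally show ?thesis using S by simp
      qed
      ultimately have "S powr (1/a) \<le> L" using S by simp
      then have "(S powr (1/a)) powr a \<le> L powr a" using a by (intro powr_mono2) auto
      then show ?thesis using a S by (simp add: powr_powr)
    qed
    show "\<exists>d. (\<forall>j. (1/2) ^ Suc j \<le> d j) \<and> (\<Sum>j<m. d j) \<le> 6 * (2 + L powr a) \<and>
      (\<forall>\<phi>\<in>dual_ball sc X. (\<Sum>j<m. (norm (\<phi> (x j)))\<^sup>2 * d j powr (1 - 2/p)) \<le> 6 * (2 + L powr a))"
    proof (intro exI[of _ "\<lambda>j. D j powr a"] conjI allI ballI)
      fix j
      have "\<delta> j powr a \<le> D j powr a" using \<delta>D \<delta>(1)[of j] a by (intro powr_mono2) auto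
      then show "(1/2) ^ Suc j \<le> D j powr a" by (simp only: \<delta>(2))
    next
      have "0 \<le> S" unfolding S_def by (intro sum_nonneg) auto
      then show "(\<Sum>j<m. D j powr a) \<le> 6 * (2 + L powr a)" using S_le by (simp add: S_def)
    next
      fix \<phi> assume \<phi>: "\<phi> \<in> dual_ball sc X"
      have e: "(D j powr a) powr (1 - 2/p) = D j powr (a - 1)" for j
      proof -
        have "a * (1 - 2/p) = a - 1" using p by (simp add: a_def field_simps)
        then show ?thesis by (simp add: powr_powr)
      qed
      show "(\<Sum>j<m. (norm (\<phi> (x j)))\<^sup>2 * (D j powr a) powr (1 - 2/p)) \<le> 6 * (2 + L powr a)"
        unfolding e using optD[OF \<phi>] S_le by simp
    qed
  qed
qed

text \<open>
  A pointwise limit of the weights for finite sections. Each partial sum is bounded along the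
  subsequence from some index on, and the bound survives the limit.
\<close>
lemma weights_for_weak_sequence:
  fixes sc :: "'k::real_or_complex \<Rightarrow> 'a::real_normed_vector \<Rightarrow> 'a"
  assumes sc: "normed_space_over sc" and X: "module.subspace sc X" and x: "\<And>j. x j \<in> X"
    and cotype: "has_cotype 2 X" and p: "1 \<le> p" "p \<le> 2"
    and weak: "\<And>\<phi> m. \<phi> \<in> dual_ball sc X \<Longrightarrow> (\<Sum>j<m. norm (\<phi> (x j)) powr p) \<le> V"
  shows "\<exists>(d :: nat \<Rightarrow> real) K. (\<forall>j. 0 < d j) \<and> (\<forall>m. (\<Sum>j<m. d j) \<le> K) \<and>
    (\<forall>\<phi>\<in>dual_ball sc X. \<forall>m. (\<Sum>j<m. (norm (\<phi> (x j)))\<^sup>2 * d j powr (1 - 2/p)) \<le> K)"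
proof -
  obtain K where "\<forall>m. \<exists>d. (\<forall>j. (1/2) ^ Suc j \<le> d j) \<and> (\<Sum>j<m. d j) \<le> K \<and>
      (\<forall>\<phi>\<in>dual_ball sc X. (\<Sum>j<m. (norm (\<phi> (x j)))\<^sup>2 * d j powr (1 - 2/p)) \<le> K)"
    using weights_for_finite_sections[where x = x, OF sc X x cotype p weak] by (rule exE)
  from choice[OF this] obtain d where d_ge: "\<And>m j. (1/2) ^ Suc j \<le> d m j" and d_sum: "\<And>m. (\<Sum>j<m. d m j) \<le> K"
    and d_weak: "\<And>m \<phi>. \<phi> \<in> dual_ball sc X \<Longrightarrow>
      (\<Sum>j<m. (norm (\<phi> (x j)))\<^sup>2 * d m j powr (1 - 2/p)) \<le> K" by blast
  have d_pos: "d m j > 0" for m j using d_ge[of j m] by (rule less_le_trans[rotated]) simp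
  have part: "(\<Sum>j<k. h j) \<le> K" if "k \<le> m" "(\<Sum>j<m. h j) \<le> K" "\<And>j. 0 \<le> h j" for k m and h :: "nat \<Rightarrow> real"
    using sum_mono2[of "{..<m}" "{..<k}" h] that by auto
  define e where "e m j = (if j < m then d m j else 0)" for m j
  have e_bound: "norm (e m j) \<le> K" for m j
  proof -
    have K0: "0 \<le> K" using d_sum[of 0] by simp
    show ?thesis
    proof (cases "j < m")
      case True
      then have "d m j \<le> (\<Sum>j<m. d m j)" using d_pos by (intro member_le_sum) (auto intro: less_imp_le)
      then show ?thesis using True d_sum[of m] d_pos[of m j] by (simp add: e_def)
    qed (simp add: e_def K0)
  qed
  have "\<exists>r. strict_mono (r :: nat \<Rightarrow> nat) \<and> (\<forall>j. \<exists>l. (\<lambda>n. e (r n) j) \<longlonglongrightarrow> l)"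
    by (rule function_convergent_subsequence[of UNIV e K]) (use e_bound in auto)
  then obtain r where r: "strict_mono (r :: nat \<Rightarrow> nat)"
    and "\<forall>j. \<exists>l. (\<lambda>n. e (r n) j) \<longlonglongrightarrow> l" by blast
  from choice[OF this(2)] obtain D where "\<forall>j. (\<lambda>n. e (r n) j) \<longlonglongrightarrow> D j" by (rule exE)
  then have D: "(\<lambda>n. e (r n) j) \<longlonglongrightarrow> D j" for j by (rule spec)
  have lim: "(\<lambda>n. d (r n) j) \<longlonglongrightarrow> D j" for j
  proof (rule Lim_transform_eventually[OF D])
    show "\<forall>\<^sub>F n in sequentially. e (r n) j = d (r n) j"
      using eventually_ge_at_top[of "Suc j"]
    proof eventually_elim
      case (elim n) then show ?case using seq_suble[OF r, of n] by (simp add: e_def)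
    qed
  qed
  have D_pos: "D j > 0" for j
  proof -
    have "(1/2) ^ Suc j \<le> D j" by (rule LIMSEQ_le_const[OF lim]) (use d_ge in blast)
    then show ?thesis by (rule less_le_trans[rotated]) simp
  qed
  have late: "\<exists>N. \<forall>n\<ge>N. m \<le> r n" for m
    using seq_suble[OF r] order_trans by blast
  show ?thesis
  proof (intro exI[of _ D] exI[of _ K] conjI allI ballI)
    show "(\<Sum>j<m. D j) \<le> K" for m
    proof (rule LIMSEQ_le_const2)
      show "(\<lambda>n. \<Sum>j<m. d (r n) j) \<longlonglongrightarrow> (\<Sum>j<m. D j)" by (intro tendsto_sum lim)
      show "\<exists>N. \<forall>n\<ge>N. (\<Sum>j<m. d (r n) j) \<le> K"
      proof -
        obtain N where "\<And>n. n \<ge> N \<Longrightarrow> m \<le> r n" using late by blast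
        then show ?thesis using part[OF _ d_sum, of m] d_pos by (auto simp: less_imp_le)
      qed
    qed
  next
    fix \<phi> m assume \<phi>: "\<phi> \<in> dual_ball sc X"
    show "(\<Sum>j<m. (norm (\<phi> (x j)))\<^sup>2 * D j powr (1 - 2/p)) \<le> K"
    proof (rule LIMSEQ_le_const2)
      show "(\<lambda>n. \<Sum>j<m. (norm (\<phi> (x j)))\<^sup>2 * d (r n) j powr (1 - 2/p)) \<longlonglongrightarrow>
         (\<Sum>j<m. (norm (\<phi> (x j)))\<^sup>2 * D j powr (1 - 2/p))"
        using D_pos by (intro tendsto_intros lim) (auto dest: less_imp_neq[symmetric])
      show "\<exists>N. \<forall>n\<ge>N. (\<Sum>j<m. (norm (\<phi> (x j)))\<^sup>2 * d (r n) j powr (1 - 2/p)) \<le> K"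
      proof -
        obtain N where "\<And>n. n \<ge> N \<Longrightarrow> m \<le> r n" using late by blast
        then show ?thesis using part[OF _ d_weak[OF \<phi>], of m] by auto
      qed
    qed
  qed (rule D_pos)
qed

section \<open>Factorization of weakly summable sequences and the inclusion theorem\<close>

text \<open>
  The finite supremum over the dual ball amounts to one real bound for all finite sections.
\<close>
lemma lp_weak_iff:
  "x \<in> lp_weak sc q X \<longleftrightarrow> (\<forall>j. x j \<in> X) \<and>
     (\<exists>V. \<forall>\<phi>\<in>dual_ball sc X. \<forall>m. (\<Sum>j<m. norm (\<phi> (x j)) powr q) \<le> V)"
proof -
  have "(SUP \<phi>\<in>dual_ball sc X. \<Sum>j. ennreal (norm (\<phi> (x j)) powr q)) < \<infinity> \<longleftrightarrow>
     (\<exists>V. \<forall>\<phi>\<in>dual_ball sc X. \<forall>m. (\<Sum>j<m. norm (\<phi> (x j)) powr q) \<le> V)" (is "?s < \<infinity> \<longleftrightarrow> ?R")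
  proof
    assume fin: "?s < \<infinity>"
    have "(\<Sum>j<m. norm (\<phi> (x j)) powr q) \<le> enn2real ?s" if "\<phi> \<in> dual_ball sc X" for \<phi> m
    proof -
      have "ennreal (\<Sum>j<m. norm (\<phi> (x j)) powr q) = (\<Sum>j<m. ennreal (norm (\<phi> (x j)) powr q))"
        by (simp add: sum_ennreal)
      also have "\<dots> \<le> (\<Sum>j. ennreal (norm (\<phi> (x j)) powr q))" by (rule sum_le_suminf) auto
      also have "\<dots> \<le> ?s" using that by (rule SUP_upper)
      also have "?s = ennreal (enn2real ?s)" using fin by (simp add: ennreal_enn2real)
      finally show ?thesis by (simp add: ennreal_le_iff)
    qed
    then show ?R by blast
  next
    assume ?R
    then obtain V where V: "\<And>\<phi> m. \<phi> \<in> dual_ball sc X \<Longrightarrow> (\<Sum>j<m. norm (\<phi> (x j)) powr q) \<le> V" by blast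
    have "?s \<le> ennreal V"
    proof (rule SUP_least)
      fix \<phi> assume \<phi>: "\<phi> \<in> dual_ball sc X"
      show "(\<Sum>j. ennreal (norm (\<phi> (x j)) powr q)) \<le> ennreal V"
      proof (rule suminf_le_const)
        show "(\<Sum>j<m. ennreal (norm (\<phi> (x j)) powr q)) \<le> ennreal V" for m
          using V[OF \<phi>, of m] by (simp add: sum_ennreal ennreal_leI)
      qed simp
    qed
    then show "?s < \<infinity>" by (rule le_less_trans) simp
  qed
  then show ?thesis by (simp add: lp_weak_def)
qed

lemma lp_weak_mono:
  assumes "0 < p" "p \<le> q"
  shows "lp_weak sc p X \<subseteq> lp_weak sc q X"
proof
  fix x assume "x \<in> lp_weak sc p X"
  then obtain V where x: "\<And>j. x j \<in> X"
    and V: "\<And>\<phi> m. \<phi> \<in> dual_ball sc X \<Longrightarrow> (\<Sum>j<m. norm (\<phi> (x j)) powr p) \<le> V"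
    unfolding lp_weak_iff by blast
  have "(\<Sum>j<m. norm (\<phi> (x j)) powr q) \<le> V powr (q/p - 1) * V" if \<phi>: "\<phi> \<in> dual_ball sc X" for \<phi> m
  proof -
    have V0: "0 \<le> V" using V[OF \<phi>, of 0] by simp
    have "norm (\<phi> (x j)) powr q \<le> V powr (q/p - 1) * norm (\<phi> (x j)) powr p" for j
    proof -
      let ?u = "norm (\<phi> (x j)) powr p"
      have "?u \<le> (\<Sum>j<Suc j. norm (\<phi> (x j)) powr p)" by (simp add: sum_nonneg)
      then have u: "?u \<le> V" using V[OF \<phi>, of "Suc j"] by simp
      have "norm (\<phi> (x j)) powr q = ?u powr (q/p - 1) * ?u"
      proof -
        have "p * (q/p - 1) + p = q" using assms by (simp add: field_simps)
        then show ?thesis by (metis powr_powr powr_add)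
      qed
      also have "\<dots> \<le> V powr (q/p - 1) * ?u"
        using u assms by (intro mult_right_mono powr_mono2) auto
      finally show ?thesis .
    qed
    then have "(\<Sum>j<m. norm (\<phi> (x j)) powr q) \<le> (\<Sum>j<m. V powr (q/p - 1) * norm (\<phi> (x j)) powr p)"
      by (rule sum_mono)
    also have "\<dots> \<le> V powr (q/p - 1) * V"
      unfolding sum_distrib_left[symmetric] using V[OF \<phi>] by (rule mult_left_mono) simp
    finally show ?thesis .
  qed
  then show "x \<in> lp_weak sc q X" unfolding lp_weak_iff using x by blast
qed

text \<open>
  For \<open>y\<^sub>j = d\<^sub>j powr (1/s - 1/p) * x\<^sub>j\<close> the number \<open>|\<phi>(y\<^sub>j)|\<^sup>s\<close> is the geometric mean of
  \<open>|\<phi>(x\<^sub>j)|\<^sup>2 d\<^sub>j powr (1 - 2/p)\<close> and \<open>d\<^sub>j\<close> with exponents \<open>s/2\<close> and \<open>1 - s/2\<close>. Both have bounded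
  sums.
\<close>
theorem lp_weak_factorization:
  fixes sc :: "'k::real_or_complex \<Rightarrow> 'a::real_normed_vector \<Rightarrow> 'a"
  assumes sc: "normed_space_over sc" and X: "module.subspace sc X"
    and cotype: "has_cotype 2 X" and p: "1 \<le> p" and s: "p \<le> s" "s \<le> 2"
    and x: "x \<in> lp_weak sc p X"
  obtains d y where "\<And>j. 0 < d j" and "summable d" and "y \<in> lp_weak sc s X"
    and "\<And>j. x j = d j powr (1/p - 1/s) *\<^sub>R y j"
proof -
  interpret normed_space_over sc by (rule sc)
  obtain V where xX: "\<And>j. x j \<in> X"
    and V: "\<And>\<phi> m. \<phi> \<in> dual_ball sc X \<Longrightarrow> (\<Sum>j<m. norm (\<phi> (x j)) powr p) \<le> V"
    using x unfolding lp_weak_iff by blast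
  obtain d K where d: "\<And>j. 0 < d j" and K: "\<And>m. (\<Sum>j<m. d j) \<le> K"
    "\<And>\<phi> m. \<phi> \<in> dual_ball sc X \<Longrightarrow> (\<Sum>j<m. (norm (\<phi> (x j)))\<^sup>2 * d j powr (1 - 2/p)) \<le> K"
    using weights_for_weak_sequence[where x = x, OF sc X xX cotype p order_trans[OF s] V] by blast
  define y where "y j = sc (of_real (d j powr (1/s - 1/p))) (x j)" for j
  have "y \<in> lp_weak sc s X"
    unfolding lp_weak_iff
  proof (intro conjI allI exI ballI)
    show "y j \<in> X" for j unfolding y_def using X xX by (intro subspace_scale)
    fix \<phi> m assume \<phi>: "\<phi> \<in> dual_ball sc X"
    have "norm (\<phi> (y j)) powr s \<le> (norm (\<phi> (x j)))\<^sup>2 * d j powr (1 - 2/p) + d j" for j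
    proof -
      let ?t = "norm (\<phi> (x j))"
      have "\<phi> (y j) = of_real (d j powr (1/s - 1/p)) * \<phi> (x j)"
        using \<phi> xX unfolding y_def dual_ball_def by blast
      then have "norm (\<phi> (y j)) powr s = ?t powr s * d j powr ((1/s - 1/p) * s)"
        by (simp add: norm_mult powr_mult powr_powr)
      also have "\<dots> = (?t\<^sup>2 * d j powr (1 - 2/p)) powr (s/2) * d j powr (1 - s/2)"
      proof -
        have "(?t\<^sup>2) powr (s/2) = ?t powr s"
        proof -
          have "(?t powr 2) powr (s/2) = ?t powr (2 * (s/2))" by (simp only: powr_powr)
          then show ?thesis by simp
        qed
        moreover have "d j powr ((1/s - 1/p) * s) = (d j powr (1 - 2/p)) powr (s/2) * d j powr (1 - s/2)"
        proof -
          have "(1/s - 1/p) * s = (1 - 2/p) * (s/2) + (1 - s/2)" using p s by (simp add: field_simps)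
          then show ?thesis by (simp only: powr_powr powr_add)
        qed
        ultimately show ?thesis by (simp add: powr_mult)
      qed
      also have "\<dots> \<le> ?t\<^sup>2 * d j powr (1 - 2/p) + d j"
        using p s d[of j] by (intro powr_product_le_sum) auto
      finally show ?thesis .
    qed
    then have "(\<Sum>j<m. norm (\<phi> (y j)) powr s) \<le> (\<Sum>j<m. (norm (\<phi> (x j)))\<^sup>2 * d j powr (1 - 2/p) + d j)"
      by (rule sum_mono)
    also have "\<dots> \<le> K + K" unfolding sum.distrib using K \<phi> by (intro add_mono)
    finally show "(\<Sum>j<m. norm (\<phi> (y j)) powr s) \<le> K + K" .
  qed
  moreover have "summable d" using d K(1) by (intro summableI_nonneg_bounded) (auto intro: less_imp_le)
  moreover have "x j = d j powr (1/p - 1/s) *\<^sub>R y j" for j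
    using d[of j] by (simp add: y_def sc_of_real flip: powr_add)
  ultimately show ?thesis using that d by blast
qed

text \<open>
  Hoelder's inequality for \<open>1/p = (1/p - 1/s) + 1/s\<close>. Stating it with \<open>d powr (1/p - 1/s)\<close>
  includes the case \<open>p = s\<close>, in which the first factor is 1 wherever \<open>d\<close> is positive.
\<close>
lemma summable_powr_product:
  fixes d u :: "nat \<Rightarrow> real"
  assumes "summable d" "summable (\<lambda>j. u j powr s)" and d: "\<And>j. 0 \<le> d j" and u: "\<And>j. 0 \<le> u j"
    and p: "0 < p" "p \<le> s"
  shows "summable (\<lambda>j. (d j powr (1/p - 1/s) * u j) powr p)"
proof (rule summable_comparison_test'[OF summable_add[OF assms(2,1)]])
  fix j
  have "(d j powr (1/p - 1/s) * u j) powr p = u j powr p * d j powr ((1/p - 1/s) * p)"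
    using d u by (simp add: powr_mult powr_powr)
  also have "\<dots> = (u j powr s) powr (p/s) * d j powr (1 - p/s)"
  proof -
    have "(1/p - 1/s) * p = 1 - p/s" "s * (p/s) = p" using p by (simp_all add: field_simps)
    then show ?thesis by (simp only: powr_powr)
  qed
  also have "\<dots> \<le> u j powr s + d j" using p d by (intro powr_product_le_sum) auto
  finally show "norm ((d j powr (1/p - 1/s) * u j) powr p) \<le> u j powr s + d j" by simp
qed

theorem abs_summing_first_exponent_decrease:
  fixes scaleX :: "'k::real_or_complex \<Rightarrow> 'a::real_normed_vector \<Rightarrow> 'a"
    and scaleZ :: "'k \<Rightarrow> 'z::real_normed_vector \<Rightarrow> 'z"
  assumes scX: "normed_space_over scaleX" and scZ: "normed_space_over scaleZ"
    and n: "n \<ge> 1" and X: "\<forall>k\<in>{1..n}. banach_subspace scaleX (X k)"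
    and cotype: "has_cotype 2 (X 1)"
    and p: "1 \<le> p" and s: "p \<le> s" "s \<le> 2" and t: "0 < t"
  shows "abs_summing scaleX scaleZ n X s ((\<lambda>_. t)(1 := s))
    \<subseteq> abs_summing scaleX scaleZ n X p ((\<lambda>_. t)(1 := p))"
proof
  fix T assume "T \<in> abs_summing scaleX scaleZ n X s ((\<lambda>_. t)(1 := s))"
  then have T: "T \<in> continuous_multilinear scaleX scaleZ n X"
    and Tsum: "\<And>x. (\<forall>k\<in>{1..n}. x k \<in> lp_weak scaleX (((\<lambda>_. t)(1 := s)) k) (X k)) \<Longrightarrow>
         (\<lambda>j. T (\<lambda>k\<in>{1..n}. x k j)) \<in> lp_strong s"
    unfolding abs_summing_def by blast+
  interpret Z: normed_space_over scaleZ by (rule scZ)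
  interpret X: normed_space_over scaleX by (rule scX)
  have one: "1 \<in> {1..n}" using n by simp
  have T_scale: "T (v(1 := scaleX c u)) = scaleZ c (T (v(1 := u)))"
    if "v \<in> PiE {1..n} X" "u \<in> X 1" for v u c
    using T that one unfolding continuous_multilinear_def mem_Collect_eq by blast
  have "(\<lambda>j. T (\<lambda>k\<in>{1..n}. x k j)) \<in> lp_strong p"
    if x: "\<forall>k\<in>{1..n}. x k \<in> lp_weak scaleX (((\<lambda>_. t)(1 := p)) k) (X k)" for x
  proof -
    have "x 1 \<in> lp_weak scaleX p (X 1)" using bspec[OF x one] by simp
    moreover have "module.subspace scaleX (X 1)" using X one by (auto simp: banach_subspace_def)
    ultimately obtain d y where d: "\<And>j. 0 < d j" "summable d" and y: "y \<in> lp_weak scaleX s (X 1)"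
      and xy: "\<And>j. x 1 j = d j powr (1/p - 1/s) *\<^sub>R y j"
      using lp_weak_factorization[OF scX _ cotype p s] by metis
    let ?x = "x(1 := y)"
    let ?u = "\<lambda>j. T (\<lambda>k\<in>{1..n}. ?x k j)"
    have "?u \<in> lp_strong s" by (rule Tsum) (use x y in \<open>auto split: if_splits\<close>)
    then have u: "summable (\<lambda>j. norm (?u j) powr s)" by (simp add: lp_strong_def)
    have "T (\<lambda>k\<in>{1..n}. x k j) = d j powr (1/p - 1/s) *\<^sub>R ?u j" for j
    proof -
      define v where "v = (\<lambda>k\<in>{1..n}. ?x k j)"
      have v: "v \<in> PiE {1..n} X" using x y by (auto simp: v_def lp_weak_iff)
      have xv: "(\<lambda>k\<in>{1..n}. x k j) = v(1 := scaleX (of_real (d j powr (1/p - 1/s))) (y j))"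
        using one xy by (auto simp: v_def fun_eq_iff X.sc_of_real)
      have "v(1 := y j) = v" by (rule fun_upd_idem) (use one in \<open>simp add: v_def\<close>)
      moreover have "T (\<lambda>k\<in>{1..n}. x k j) = scaleZ (of_real (d j powr (1/p - 1/s))) (T (v(1 := y j)))"
        unfolding xv by (rule T_scale[OF v]) (use y in \<open>simp add: lp_weak_iff\<close>)
      ultimately have "T (\<lambda>k\<in>{1..n}. x k j) = d j powr (1/p - 1/s) *\<^sub>R T v"
        by (simp only: Z.sc_of_real)
      then show ?thesis by (simp only: v_def)
    qed
    then have "norm (T (\<lambda>k\<in>{1..n}. x k j)) = d j powr (1/p - 1/s) * norm (?u j)" for j by simp
    moreover have "summable (\<lambda>j. (d j powr (1/p - 1/s) * norm (?u j)) powr p)"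
      using d u p s by (intro summable_powr_product) (auto intro: less_imp_le)
    ultimately show ?thesis by (simp add: lp_strong_def)
  qed
  moreover have "1 / p \<le> (\<Sum>k=1..n. 1 / ((\<lambda>_. t)(1 := p)) k)"
  proof -
    define q where "q = (\<lambda>_::nat. t)(1 := p)"
    have "q k > 0" for k using p t by (simp add: q_def)
    then have "1 / q 1 \<le> (\<Sum>k=1..n. 1 / q k)"
      using one by (intro member_le_sum[of 1 "{1..n}" "\<lambda>k. 1 / q k"]) (auto simp: less_imp_le)
    then show ?thesis by (simp add: q_def)
  qed
  ultimately show "T \<in> abs_summing scaleX scaleZ n X p ((\<lambda>_. t)(1 := p))"
    using T p t unfolding abs_summing_def by simp
qed

lemma abs_summing_antimono:
  assumes q: "\<And>k. k \<in> {1..n} \<Longrightarrow> 0 < q k" and r: "\<And>k. k \<in> {1..n} \<Longrightarrow> q k \<le> r k"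
  shows "abs_summing scaleX scaleZ n X p r \<subseteq> abs_summing scaleX scaleZ n X p q"
proof
  fix T assume T: "T \<in> abs_summing scaleX scaleZ n X p r"
  have "(\<Sum>k=1..n. 1 / r k) \<le> (\<Sum>k=1..n. 1 / q k)"
    using q r by (intro sum_mono divide_left_mono) (auto intro: mult_pos_pos less_le_trans)
  moreover have "lp_weak scaleX (q k) (X k) \<subseteq> lp_weak scaleX (r k) (X k)" if "k \<in> {1..n}" for k
    using q[OF that] r[OF that] by (rule lp_weak_mono)
  ultimately show "T \<in> abs_summing scaleX scaleZ n X p q"
    using T q unfolding abs_summing_def by (blast intro: order_trans)
qed

theorem theorem4p2:
  fixes scaleX :: "'k::real_or_complex \<Rightarrow> 'a::real_normed_vector \<Rightarrow> 'a"
    and scaleZ :: "'k \<Rightarrow> 'z::banach \<Rightarrow> 'z"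
    and n :: nat and X :: "nat \<Rightarrow> 'a set" and p s :: real
  assumes "normed_space_over scaleX" and "normed_space_over scaleZ"
    and "n \<ge> 1"
    and "\<forall>k\<in>{1..n}. banach_subspace scaleX (X k)"
    and "has_cotype 2 (X 1)"
    and "1 \<le> p" and "p \<le> s" and "s \<le> 2"
  shows "(\<forall>t\<ge>1. abs_summing scaleX scaleZ n X s ((\<lambda>_. t)(1 := s))
                \<subseteq> abs_summing scaleX scaleZ n X p ((\<lambda>_. t)(1 := p))) \<and>
         abs_summing scaleX scaleZ n X s (\<lambda>_. s)
           \<subseteq> abs_summing scaleX scaleZ n X p ((\<lambda>_. s)(1 := p)) \<and>
         abs_summing scaleX scaleZ n X p ((\<lambda>_. s)(1 := p))
           \<subseteq> abs_summing scaleX scaleZ n X p (\<lambda>_. p)"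
proof -
  have main: "abs_summing scaleX scaleZ n X s ((\<lambda>_. t)(1 := s))
      \<subseteq> abs_summing scaleX scaleZ n X p ((\<lambda>_. t)(1 := p))" if "t \<ge> 1" for t
    using that by (intro abs_summing_first_exponent_decrease assms) simp
  have "(\<lambda>_. s)(1 := s) = (\<lambda>_::nat. s)" by auto
  then have "abs_summing scaleX scaleZ n X s (\<lambda>_. s)
      \<subseteq> abs_summing scaleX scaleZ n X p ((\<lambda>_. s)(1 := p))"
    using main[of s] assms(6,7) by simp
  moreover have "abs_summing scaleX scaleZ n X p ((\<lambda>_. s)(1 := p))
      \<subseteq> abs_summing scaleX scaleZ n X p (\<lambda>_. p)"
    using assms(6,7) by (intro abs_summing_antimono) auto
  ultimately show ?thesis using main by blast
qed

end
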